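(* For every prime $p$, one has $M(p)\le \frac{2}{3}p$.
   Context: For a positive integer $n$, the $n$-th cyclotomic polynomial is $\Phi_n(x)=\prod_{1\le j\le n,\ \gcd(j,n)=1}(x-e^{2\pi i j/n})=\sum_{k=0}^{\varphi(n)}a_n(k)x^k$, which has integer coefficients. The height of $\Phi_n$ is $A(n)=\max\{|a_n(k)|:0\le k\le\varphi(n)\}$. For a prime $p$, $M(p)=\max\{A(pqr): q,r \text{ primes with } p<q<r\}$ (this maximum exists since $A(pqr)\le p-1$). *)

theory Defs
  imports Complex_Main "HOL-Computational_Algebra.Polynomial" "HOL-Number_Theory.Totient"
begin

definition cyclotomic_poly :: "nat \<Rightarrow> complex poly" where
  "cyclotomic_poly n =
     (\<Prod>j | 1 \<le> j \<and> j \<le> n \<and> coprime j n.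
        [: - exp (2 * of_real pi * \<i> * of_nat j / of_nat n), 1 :])"

text \<open>
  The coefficients are complex numbers here, although they are in fact integers;
  their absolute value is the complex norm.
\<close>

definition cyclotomic_height :: "nat \<Rightarrow> real" where
  "cyclotomic_height n = Max {cmod (coeff (cyclotomic_poly n) k) | k. k \<le> totient n}"

text \<open>
  There are infinitely many pairs of primes \<open>q\<close>, \<open>r\<close> with \<open>p < q < r\<close>, but the set
  of heights below is finite and nonempty for prime \<open>p\<close>: the heights are natural
  numbers, and they are bounded by \<open>p - 1\<close>. So \<open>Max\<close> is the genuine maximum.
\<close>

definition max_ternary_height :: "nat \<Rightarrow> real" where
  "max_ternary_height p =
     Max {cyclotomic_height (p * q * r) | q r. prime q \<and> prime r \<and> p < q \<and> q < r}"

end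

theory Submission
  imports Defs "HOL-Number_Theory.Cong" "HOL-Computational_Algebra.Fundamental_Theorem_Algebra"
begin

text \<open>
  Write $k \equiv a q r + b p r + c p q$ modulo $p q r$ with digits $0 \le a < p$, $0 \le b < q$,
  $0 \le c < r$, and let $S$ be the resulting carry. The coefficient of $x^n$ is the sum, over the
  $p$ integers $k$ in $(n - p, n]$, of the second difference (with steps $q$ and $r$) of the
  indicator of $S = 0$. In such a window every digit $a$ occurs exactly once, and whether $k$ contributes
  $1$, $0$ or $-1$ depends only on $a$, on the carry, and on whether $b$ and $c$ are large. Up to sign
  the inverses of $r$ and $q$ modulo $p$ may be taken to be $s \le t \le p / 2$, and at most $p - t$ digits can
  contribute $1$, so only $t < p / 3$ matters.

  If the sum exceeded $2 p / 3$, then nearly all digits would have to behave optimally. Two $k$ with large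
  $b$ and large $c$ differ by a shift for which both $b$ and $c$ move by less than the size of
  the box; this rigidity forces, for every digit shift $x$ near $p / 3$, all transitions between the
  three types of optimal digits (carry $0$, $1$, $2$) to be realized by one and the same
  integer difference of the $k$. These differences add up to zero along closed cycles of digits,
  hence are explicit multiples of one of them, say of $w$. On the one hand the $k$ with large $b$ and $c$
  have pairwise differences different from $w$ and $2 w$, which bounds their number by $(p + 2 w) / 3$;
  on the other hand a shift by a large multiple of $w$ leaves the window too often. The two bounds contradict
  each other.
\<close>

section \<open>Windows of residues\<close>

text \<open>Division by \<open>Q\<close> confines \<open>X\<close> to the \<open>k\<close>
  consecutive integers after \<open>z div Q\<close>.\<close>

lemma card_window:
  fixes Q :: int
  assumes Q: "0 < Q" and k: "0 \<le> k" and X: "\<And>x. x \<in> X \<Longrightarrow> z < x * Q \<and> x * Q \<le> z + k * Q"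
  shows "finite X" "int (card X) \<le> k"
proof -
  have sub: "X \<subseteq> {z div Q + 1 .. z div Q + k}"
  proof
    fix x assume "x \<in> X"
    from X[OF this] have 1: "z < x * Q" and 2: "x * Q \<le> z + k * Q" by auto
    have "z div Q * Q < x * Q" using 1 Q div_mult_mod_eq[of z Q] pos_mod_sign[of Q z] by linarith
    then have "z div Q < x" using Q by (simp only: mult_less_cancel_right_pos)
    moreover have "x \<le> (z + k * Q) div Q" using zdiv_mono1[OF 2 Q] Q by simp
    then have "x \<le> z div Q + k" using Q by simp
    ultimately show "x \<in> {z div Q + 1 .. z div Q + k}" by simp
  qed
  then show "finite X" using finite_subset by blast
  have "card X \<le> card {z div Q + 1 .. z div Q + k}" using sub by (intro card_mono) auto
  then show "int (card X) \<le> k" using k by simp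
qed

text \<open>
  All data are indexed by the digit \<open>a\<close>: \<open>K a\<close> is the integer of the window with first digit \<open>a\<close>, and
  \<open>b a\<close>, \<open>c a\<close>, \<open>S a\<close> are its other digits and its carry. The error $\pm 1$ in \<open>sC\<close> and \<open>tB\<close>
  allows \<open>s\<close> and \<open>t\<close> to be the inverses of \<open>r\<close> and \<open>q\<close> modulo \<open>p\<close> or their negatives.
\<close>
locale ternary_window =
  fixes p q r s t B C n :: int and K b c S :: "int \<Rightarrow> int"
  assumes p2: "2 \<le> p" and pq: "p < q" and pr: "p < r"
    and cop: "coprime p q" "coprime p r" "coprime q r"
    and s1: "1 \<le> s" and st: "s \<le> t" and stp: "s + t \<le> p"
    and sC: "\<bar>s * r + C * p - p * r\<bar> = 1" and tB: "\<bar>t * q + B * p - p * q\<bar> = 1"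
    and nlo: "- q - r \<le> n" and nhi: "n < p * q * r - q - r"
    and F: "\<And>a. 0 \<le> a \<Longrightarrow> a < p \<Longrightarrow>
              a * (q * r) + b a * (p * r) + c a * (p * q) = K a + S a * (p * q * r)"
    and b: "\<And>a. 0 \<le> a \<Longrightarrow> a < p \<Longrightarrow> 0 \<le> b a \<and> b a < q"
    and c: "\<And>a. 0 \<le> a \<Longrightarrow> a < p \<Longrightarrow> 0 \<le> c a \<and> c a < r"
    and K: "\<And>a. 0 \<le> a \<Longrightarrow> a < p \<Longrightarrow> n - p < K a \<and> K a \<le> n"
begin

text \<open>
  \<open>U\<close>, \<open>G\<close> and \<open>E\<close> are the digits that contribute \<open>1\<close>; on \<open>{t..<s+t}\<close> the contribution is \<open>-1\<close> except
  on \<open>L\<close> and \<open>H\<close>. The digits with large \<open>b\<close> and \<open>c\<close> (the box) are \<open>E\<close>, \<open>G\<close> and, once \<open>n\<close> is large enough, \<open>H\<close>.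
\<close>
definition U where "U = {a. 0 \<le> a \<and> a < s \<and> S a = 0}"
definition G where "G = {a. 0 \<le> a \<and> a < s \<and> S a = 1 \<and> B \<le> b a \<and> C \<le> c a}"
definition L where "L = {a. t \<le> a \<and> a < s + t \<and> S a = 1 \<and> b a < B \<and> c a < C}"
definition H where "H = {a. t \<le> a \<and> a < s + t \<and> S a = 2}"
definition E where "E = {a. s + t \<le> a \<and> a < p \<and> B \<le> b a \<and> C \<le> c a}"

text \<open>
  The second difference of the indicator of carry \<open>0\<close>: stepping by \<open>q\<close> changes the carry by
  \<open>[a < s] - [C \<le> c a]\<close>, stepping by \<open>r\<close> changes it by \<open>[a < t] - [B \<le> b a]\<close>.
\<close>
definition T :: "int \<Rightarrow> int" where
  "T a = of_bool (S a = 0) - of_bool (S a + of_bool (a < s) = of_bool (C \<le> c a))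
       - of_bool (S a + of_bool (a < t) = of_bool (B \<le> b a))
       + of_bool (S a + of_bool (a < s + t) = of_bool (B \<le> b a) + of_bool (C \<le> c a))"

section \<open>Carries and the contribution of a single digit\<close>

lemma pos: "0 < p" "0 < q" "0 < r" "0 < q * r" "0 < p * r" "0 < p * q" "0 < p * q * r"
  using p2 pq pr by auto

text \<open>Up to sign and modulo \<open>p * q * r\<close>, a step by \<open>q\<close> is
  \<open>s\<close> units of the first digit and \<open>C\<close> units of the third.\<close>

lemma sC': "\<bar>s * (q * r) + C * (p * q) - p * q * r\<bar> = q"
proof -
  have "s * (q * r) + C * (p * q) - p * q * r = q * (s * r + C * p - p * r)" by (simp add: algebra_simps)
  then show ?thesis using sC pos by (simp add: abs_mult)
qed

lemma tB': "\<bar>t * (q * r) + B * (p * r) - p * q * r\<bar> = r"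
proof -
  have "t * (q * r) + B * (p * r) - p * q * r = r * (t * q + B * p - p * q)" by (simp add: algebra_simps)
  then show ?thesis using tB pos by (simp add: abs_mult)
qed

lemma sum_lt_products: "q + r + p < p * r + p * q"
proof -
  have "2 * r \<le> p * r" "2 * q \<le> p * q" using p2 pos by auto
  then show ?thesis using pq pos by linarith
qed

lemma double_sum_le_products: "2 * q + r + p \<le> q * r + p * q"  "2 * r + q + p \<le> q * r + p * r"
proof -
  have "2 * r \<le> q * r" "2 * q \<le> q * r" "2 * q \<le> p * q" "2 * r \<le> p * r"
    using p2 pq pr pos by auto
  then show "2 * q + r + p \<le> q * r + p * q" "2 * r + q + p \<le> q * r + p * r" 
    using pq pr by linarith+
qed

lemma S_range:
  assumes "0 \<le> a" "a < p"
  shows "0 \<le> S a" "S a \<le> 2"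
proof -
  have 1: "a * (q * r) \<ge> 0" "b a * (p * r) \<ge> 0" "c a * (p * q) \<ge> 0"
    using assms b[OF assms] c[OF assms] pos by auto
  have 2: "a * (q * r) \<le> (p - 1) * (q * r)" "b a * (p * r) \<le> (q - 1) * (p * r)" "c a * (p * q) \<le> (r - 1) * (p * q)"
    using assms b[OF assms] c[OF assms] pos by (auto intro!: mult_right_mono)
  have "(-1) * (p*q*r) < S a * (p * q * r)"
    using F[OF assms] K[OF assms] 1 nhi pos by linarith
  then have "- 1 < S a" using pos(7) by (simp only: mult_less_cancel_right_pos)
  then show "0 \<le> S a" by simp
  have e: "(p - 1) * (q * r) + (q - 1) * (p * r) + (r - 1) * (p * q) = 3 * (p*q*r) - q*r - p*r - p*q"
    by (simp add: algebra_simps)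
  have "S a * (p * q * r) < 3 * (p*q*r)"
    using F[OF assms] K[OF assms] 2 e nlo sum_lt_products pos by linarith
  then have "S a < 3" using pos(7) by (simp only: mult_less_cancel_right_pos)
  then show "S a \<le> 2" by simp
qed

text \<open>By \<open>sC'\<close> and \<open>tB'\<close>, reaching these thresholds makes the digit
  sum at least \<open>p * q * r - q - r\<close>, in the last case
  \<open>2 * p * q * r - q - r\<close>, whereas \<open>K a\<close> is smaller than
  \<open>p * q * r - q - r\<close>.\<close>

lemma S_lower:
  assumes "0 \<le> a" "a < p"
  shows "s \<le> a \<Longrightarrow> C \<le> c a \<Longrightarrow> 1 \<le> S a"
    and "t \<le> a \<Longrightarrow> B \<le> b a \<Longrightarrow> 1 \<le> S a"
    and "B \<le> b a \<Longrightarrow> C \<le> c a \<Longrightarrow> 1 \<le> S a"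
    and "s + t \<le> a \<Longrightarrow> B \<le> b a \<Longrightarrow> C \<le> c a \<Longrightarrow> S a = 2"
proof -
  note Fa = F[OF assms] and Ka = K[OF assms]
  have nn: "a * (q * r) \<ge> 0" "b a * (p * r) \<ge> 0" "c a * (p * q) \<ge> 0"
    using assms b[OF assms] c[OF assms] pos by auto
  have cc: "C * (p * q) \<le> c a * (p * q)" if "C \<le> c a" using that pos by (auto intro!: mult_right_mono)
  have bb: "B * (p * r) \<le> b a * (p * r)" if "B \<le> b a" using that pos by (auto intro!: mult_right_mono)
  have m: "x * (q * r) \<le> a * (q * r)" if "x \<le> a" for x using that pos by (auto intro!: mult_right_mono)
  have 1: "1 \<le> S a" if "0 * (p*q*r) < S a * (p * q * r)"
    using that pos(7) unfolding mult_less_cancel_right_pos[OF pos(7)] by linarith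
  have 2: "2 \<le> S a" if "1 * (p*q*r) < S a * (p * q * r)"
    using that pos(7) unfolding mult_less_cancel_right_pos[OF pos(7)] by linarith
  show "1 \<le> S a" if "s \<le> a" "C \<le> c a"
    by (rule 1) (use m[OF that(1)] cc[OF that(2)] sC' Fa Ka nhi nn pos in linarith)
  show "1 \<le> S a" if "t \<le> a" "B \<le> b a"
    by (rule 1) (use m[OF that(1)] bb[OF that(2)] tB' Fa Ka nhi nn pos in linarith)
  have st': "(s + t) * (q * r) = s * (q * r) + t * (q * r)" by (simp add: algebra_simps)
  have "(s + t) * (q * r) \<le> p * (q * r)" using stp pos by (auto intro!: mult_right_mono)
  then have st2: "s * (q * r) + t * (q * r) \<le> p * q * r" by (simp add: algebra_simps)
  show "1 \<le> S a" if "B \<le> b a" "C \<le> c a"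
    by (rule 1) (use bb[OF that(1)] cc[OF that(2)] sC' tB' st2 Fa Ka nhi nn pos in linarith)
  have "2 \<le> S a" if "s + t \<le> a" "B \<le> b a" "C \<le> c a"
    by (rule 2) (use m[OF that(1)] bb[OF that(2)] cc[OF that(3)] sC' tB' st' Fa Ka nhi nn pos in linarith)
  then show "S a = 2" if "s + t \<le> a" "B \<le> b a" "C \<le> c a"
    using that S_range[OF assms] by force
qed

text \<open>A finite check over the three carries and the positions of the digits;
  \<open>S_lower\<close> removes the combinations that would violate the bounds.\<close>

lemma T_upper:
  assumes "0 \<le> a" "a < p"
  shows "T a \<le> of_bool (a \<in> U) + of_bool (a \<in> G) + of_bool (a \<in> E) + of_bool (a \<in> L) + of_bool (a \<in> H)
             - of_bool (t \<le> a \<and> a < s + t)"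
    and "T a \<le> 1 - of_bool (s \<le> a \<and> a < s + t)"
    and "- of_bool (s \<le> a \<and> a < s + t) \<le> T a"
proof -
  have "S a = 0 \<or> S a = 1 \<or> S a = 2" using S_range[OF assms] by linarith
  then have "T a \<le> of_bool (a \<in> U) + of_bool (a \<in> G) + of_bool (a \<in> E) + of_bool (a \<in> L) + of_bool (a \<in> H)
             - of_bool (t \<le> a \<and> a < s + t) \<and> T a \<le> 1 - of_bool (s \<le> a \<and> a < s + t)
     \<and> - of_bool (s \<le> a \<and> a < s + t) \<le> T a"
    using S_lower[OF assms] assms s1 st stp
    unfolding T_def U_def G_def E_def L_def H_def
    by (cases "a < s"; cases "a < t"; cases "a < s + t"; cases "B \<le> b a"; cases "C \<le> c a") auto
  then show "T a \<le> of_bool (a \<in> U) + of_bool (a \<in> G) + of_bool (a \<in> E) + of_bool (a \<in> L) + of_bool (a \<in> H)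
             - of_bool (t \<le> a \<and> a < s + t)"
    "T a \<le> 1 - of_bool (s \<le> a \<and> a < s + t)"
    "- of_bool (s \<le> a \<and> a < s + t) \<le> T a" by auto
qed

section \<open>Counting the regions of digits\<close>

lemma region_subset: "U \<subseteq> {0..<s}" "G \<subseteq> {0..<s}" "L \<subseteq> {t..<s+t}" "H \<subseteq> {t..<s+t}" "E \<subseteq> {s+t..<p}"
  unfolding U_def G_def L_def H_def E_def by auto

lemma finite_region [simp]: "finite U" "finite G" "finite L" "finite H" "finite E"
  using region_subset by (auto intro: finite_subset)

lemma in_range:
  "a \<in> U \<Longrightarrow> 0 \<le> a \<and> a < s \<and> a < p" "a \<in> G \<Longrightarrow> 0 \<le> a \<and> a < s \<and> a < p"
  "a \<in> L \<Longrightarrow> t \<le> a \<and> a < s + t \<and> 0 \<le> a \<and> a < p" "a \<in> H \<Longrightarrow> t \<le> a \<and> a < s + t \<and> 0 \<le> a \<and> a < p"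
  "a \<in> E \<Longrightarrow> s + t \<le> a \<and> a < p \<and> 0 \<le> a"
  using region_subset s1 st stp by fastforce+

lemma card_regions:
  "int (card U) + card G \<le> s" "int (card L) + card H \<le> s" "int (card E) \<le> p - s - t"
proof -
  have "card (U \<union> G) \<le> card {0..<s}" using region_subset(1,2) by (intro card_mono) auto
  moreover have "card (U \<union> G) = card U + card G" by (rule card_Un_disjoint[OF finite_region(1,2)]) (auto simp: U_def G_def)
  ultimately show "int (card U) + card G \<le> s" using s1 by simp
  have "card (L \<union> H) \<le> card {t..<s+t}" using region_subset(3,4) by (intro card_mono) auto
  moreover have "card (L \<union> H) = card L + card H" by (rule card_Un_disjoint[OF finite_region(3,4)]) (auto simp: L_def H_def)
  ultimately show "int (card L) + card H \<le> s" using s1 by simp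
  have "card E \<le> card {s+t..<p}" using region_subset(5) by (intro card_mono) auto
  then show "int (card E) \<le> p - s - t" using stp by simp
qed

lemma sum_of_bool_mem:
  assumes "X \<subseteq> {0..<p}" shows "(\<Sum>a\<in>{0..<p}. of_bool (a \<in> X)) = int (card X)"
proof -
  have "{0..<p} \<inter> {a. a \<in> X} = X" using assms by auto
  then show ?thesis by (simp add: sum_of_bool_eq)
qed

lemma sum_of_bool_ivl:
  assumes "0 \<le> x" "x \<le> y" "y \<le> p"
  shows "(\<Sum>a\<in>{0..<p}. of_bool (x \<le> a \<and> a < y)) = y - x"
proof -
  have "(\<Sum>a\<in>{0..<p}. of_bool (a \<in> {x..<y})) = int (card {x..<y})"
    by (rule sum_of_bool_mem) (use assms in auto)
  then show ?thesis using assms by simp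
qed

lemma sum_T_le: "(\<Sum>a\<in>{0..<p}. T a) \<le> int (card U) + card G + card E + card L + card H - s"
proof -
  have "(\<Sum>a\<in>{0..<p}. T a) \<le> (\<Sum>a\<in>{0..<p}. of_bool (a \<in> U) + of_bool (a \<in> G) + of_bool (a \<in> E)
      + of_bool (a \<in> L) + of_bool (a \<in> H) - of_bool (t \<le> a \<and> a < s + t))"
    by (rule sum_mono) (use T_upper(1) in auto)
  also have "\<dots> = int (card U) + card G + card E + card L + card H - s"
  proof -
    have "U \<subseteq> {0..<p}" "G \<subseteq> {0..<p}" "E \<subseteq> {0..<p}" "L \<subseteq> {0..<p}" "H \<subseteq> {0..<p}"
      using in_range by force+
    then show ?thesis using s1 st stp
      by (simp only: sum.distrib sum_subtractf sum_of_bool_mem) (subst sum_of_bool_ivl, auto)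
  qed
  finally show ?thesis .
qed

lemma sum_T_le': "(\<Sum>a\<in>{0..<p}. T a) \<le> p - t"
proof -
  have "(\<Sum>a\<in>{0..<p}. T a) \<le> (\<Sum>a\<in>{0..<p}. 1 - of_bool (s \<le> a \<and> a < s + t))"
    by (rule sum_mono) (use T_upper(2) in auto)
  also have "\<dots> = p - t" 
    using s1 st stp p2 by (simp only: sum_subtractf) (subst sum_of_bool_ivl, auto)
  finally show ?thesis .
qed

lemma sum_T_ge: "- t \<le> (\<Sum>a\<in>{0..<p}. T a)"
proof -
  have "- t = (\<Sum>a\<in>{0..<p}. - of_bool (s \<le> a \<and> a < s + t))"
    using s1 st stp p2 by (simp only: sum_negf) (subst sum_of_bool_ivl, auto)
  also have "\<dots> \<le> (\<Sum>a\<in>{0..<p}. T a)"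
    by (rule sum_mono) (use T_upper(3) in auto)
  finally show ?thesis .
qed

lemma digit_mult:
  assumes "0 \<le> a" "a < p"
  shows "b a * (p * r) \<le> p * q * r - p * r" "c a * (p * q) \<le> p * q * r - p * q"
    and "B \<le> b a \<Longrightarrow> p * q * r - t * (q * r) - r \<le> b a * (p * r)"
    and "C \<le> c a \<Longrightarrow> p * q * r - s * (q * r) - q \<le> c a * (p * q)"
    and "b a < B \<Longrightarrow> b a * (p * r) \<le> p * q * r - t * (q * r) + r - p * r"
    and "c a < C \<Longrightarrow> c a * (p * q) \<le> p * q * r - s * (q * r) + q - p * q"
proof -
  have "b a * (p * r) \<le> (q - 1) * (p * r)" "c a * (p * q) \<le> (r - 1) * (p * q)"
    using b[OF assms] c[OF assms] pos by (auto intro!: mult_right_mono)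
  then show "b a * (p * r) \<le> p * q * r - p * r" "c a * (p * q) \<le> p * q * r - p * q"
    by (simp_all add: algebra_simps)
  have "B * (p * r) \<le> b a * (p * r)" if "B \<le> b a" using that pos by (auto intro!: mult_right_mono)
  then show "B \<le> b a \<Longrightarrow> p * q * r - t * (q * r) - r \<le> b a * (p * r)" using tB' by linarith
  have "C * (p * q) \<le> c a * (p * q)" if "C \<le> c a" using that pos by (auto intro!: mult_right_mono)
  then show "C \<le> c a \<Longrightarrow> p * q * r - s * (q * r) - q \<le> c a * (p * q)" using sC' by linarith
  have "b a * (p * r) \<le> (B - 1) * (p * r)" if "b a < B" using that pos by (auto intro!: mult_right_mono)
  then show "b a < B \<Longrightarrow> b a * (p * r) \<le> p * q * r - t * (q * r) + r - p * r"
    unfolding left_diff_distrib using tB' by linarith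
  have "c a * (p * q) \<le> (C - 1) * (p * q)" if "c a < C" using that pos by (auto intro!: mult_right_mono)
  then show "c a < C \<Longrightarrow> c a * (p * q) \<le> p * q * r - s * (q * r) + q - p * q"
    unfolding left_diff_distrib using sC' by linarith
qed

lemma E_S: "a \<in> E \<Longrightarrow> S a = 2" using S_lower(4) in_range(5) unfolding E_def by blast

text \<open>For these digits the size of \<open>b\<close> and \<open>c\<close> confines \<open>a\<close>, or \<open>a + p\<close> on \<open>G\<close>, to an arc of length \<open>s + t\<close>.\<close>
lemma card_arc: "int (card E) + card G + card H \<le> s + t"
proof -
  define z where "z = n - p + p * r + p * q"
  let ?X = "E \<union> H \<union> (\<lambda>a. a + p) ` G"
  have "card ?X = card E + card H + card G"
  proof -
    have "(E \<union> H) \<inter> (\<lambda>a. a + p) ` G = {}" "E \<inter> H = {}" using in_range by force+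
    then show ?thesis by (simp add: card_Un_disjoint card_image)
  qed
  moreover have "int (card ?X) \<le> s + t"
  proof (rule card_window(2)[of "q * r" _ _ z])
    show "0 < q * r" "0 \<le> s + t" using pos s1 st by auto
    fix x assume "x \<in> ?X"
    then consider "x \<in> E" | "x \<in> H" | a where "x = a + p" "a \<in> G" by auto
    then show "z < x * (q * r) \<and> x * (q * r) \<le> z + (s + t) * (q * r)"
    proof cases
      case 1
      then have r: "0 \<le> x" "x < p" "B \<le> b x" "C \<le> c x" using in_range(5)[OF 1] by (auto simp: E_def)
      show ?thesis using F[OF r(1,2)] K[OF r(1,2)] digit_mult(1,2)[OF r(1,2)]
        digit_mult(3,4)[OF r(1,2)] r(3,4) sum_lt_products unfolding z_def distrib_right E_S[OF 1] by linarith
    next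
      case 2
      then have r: "0 \<le> x" "x < p" "x \<le> s + t - 1" "S x = 2" using in_range(4)[OF 2] by (auto simp: H_def)
      have "x * (q * r) \<le> (s + t - 1) * (q * r)" using r pos by (intro mult_right_mono) auto
      then show ?thesis using F[OF r(1,2)] K[OF r(1,2)] r(4) digit_mult(1,2)[OF r(1,2)] nlo sum_lt_products pos
        unfolding z_def distrib_right left_diff_distrib r(4) by linarith
    next
      case 3
      have r: "0 \<le> a" "a < p" "B \<le> b a" "C \<le> c a" "S a = 1"
        using in_range(2)[OF 3(2)] 3(2)[unfolded G_def] by simp_all
      have "x * (q * r) = a * (q * r) + p * q * r" unfolding 3(1) by (simp add: algebra_simps)
      then show ?thesis using F[OF r(1,2)] K[OF r(1,2)] digit_mult(1,2)[OF r(1,2)]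
        digit_mult(3,4)[OF r(1,2)] r(3,4) sum_lt_products unfolding z_def distrib_right r(5) by linarith
    qed
  qed
  ultimately show ?thesis by simp
qed

text \<open>The digit \<open>a'\<close> forces \<open>n\<close> up to at least
  \<open>t * q * r - q - r\<close>; then carry 2 on \<open>H\<close> is out of reach for small
  \<open>b\<close> or small \<open>c\<close>.\<close>

lemma H_in_box_if:
  assumes e: "a' \<in> E" "s + 2 * t \<le> a'" and a: "a \<in> H"
  shows "B \<le> b a \<and> C \<le> c a"
proof -
  have r': "0 \<le> a'" "a' < p" "B \<le> b a'" "C \<le> c a'" using e in_range(5)[OF e(1)] by (auto simp: E_def)
  have "(s + 2 * t) * (q * r) \<le> a' * (q * r)" using e pos by (intro mult_right_mono) auto
  then have n: "t * (q * r) - q - r \<le> n"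
    using F[OF r'(1,2)] K[OF r'(1,2)] digit_mult(3,4)[OF r'(1,2)] r'(3,4)
    unfolding E_S[OF e(1)] distrib_right mult.assoc[of 2] by linarith
  have r: "0 \<le> a" "a < p" "a \<le> s + t - 1" "S a = 2" using a in_range(4)[OF a] by (auto simp: H_def)
  have aQ: "a * (q * r) \<le> s * (q * r) + t * (q * r) - q * r"
    using mult_right_mono[OF r(3), of "q * r"] pos by (simp add: distrib_right left_diff_distrib)
  have stQ: "s * (q * r) \<le> t * (q * r)" using st pos by (intro mult_right_mono) auto
  note * = F[OF r(1,2), unfolded r(4)] K[OF r(1,2)] n aQ stQ double_sum_le_products sum_lt_products digit_mult(1,2)[OF r(1,2)]
  have "\<not> b a < B"
  proof
    assume "b a < B"
    from digit_mult(5)[OF r(1,2) this] * pos show False by linarith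
  qed
  moreover have "\<not> c a < C"
  proof
    assume "c a < C"
    from digit_mult(6)[OF r(1,2) this] * pos show False by linarith
  qed
  ultimately show ?thesis by simp
qed

section \<open>Differences of window values modulo \<open>p\<close>\<close>

lemma K_mod: "0 \<le> a \<Longrightarrow> a < p \<Longrightarrow> p dvd K a - a * (q * r)"
proof -
  assume a: "0 \<le> a" "a < p"
  have "K a - a * (q * r) = p * (b a * r + c a * q - S a * (q * r))"
    using F[OF a] by (simp add: algebra_simps)
  then show ?thesis by simp
qed

lemma cop_pQ: "coprime p (q * r)" using cop by simp

lemma K_diff_mod:
  assumes "0 \<le> a" "a < p" "0 \<le> a'" "a' < p"
  shows "p dvd K a' - K a - (a' - a) * (q * r)"
  using dvd_diff[OF K_mod[OF assms(3,4)] K_mod[OF assms(1,2)]] by (simp add: algebra_simps)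

text \<open>As \<open>q * r\<close> is invertible modulo \<open>p\<close>, the residue of a
  difference of window values determines the digit shift.\<close>

lemma shift_of_K_diff:
  assumes "0 \<le> a" "a < p" "0 \<le> a'" "a' < p" and "p dvd K a' - K a - x * (q * r)"
  shows "a' = (a + x) mod p"
proof -
  have "p dvd (K a' - K a - x * (q * r)) - (K a' - K a - (a' - a) * (q * r))"
    by (rule dvd_diff[OF assms(5) K_diff_mod[OF assms(1-4)]])
  then have "p dvd ((a' - (a + x)) * (q * r))" by (simp add: algebra_simps)
  then have "p dvd (a' - (a + x))" using cop_pQ by (simp add: coprime_dvd_mult_left_iff)
  then have "a' mod p = (a + x) mod p" by (simp add: mod_eq_dvd_iff)
  then show ?thesis using assms by simp
qed

lemma K_inj: "0 \<le> a \<Longrightarrow> a < p \<Longrightarrow> 0 \<le> a' \<Longrightarrow> a' < p \<Longrightarrow> K a = K a' \<Longrightarrow> a = a'"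
  using shift_of_K_diff[of a' a 0] by simp

lemma K_diff_lt: "0 \<le> a \<Longrightarrow> a < p \<Longrightarrow> 0 \<le> a' \<Longrightarrow> a' < p \<Longrightarrow> \<bar>K a' - K a\<bar> < p"
  using K[of a] K[of a'] by linarith

lemma sh_range: "0 \<le> (a + x) mod p" "(a + x) mod p < p" using pos by auto

lemma K_sh_mod:
  assumes "0 \<le> a" "a < p" shows "p dvd K ((a + x) mod p) - K a - x * (q * r)"
proof -
  obtain d where d: "x = ((a + x) mod p - a) + p * d"
    by (rule that[of "(a + x) div p"]) (simp add: minus_mult_div_eq_mod[symmetric])
  have "x * (q * r) = ((a + x) mod p - a) * (q * r) + p * (d * (q * r))"
    by (subst d) (simp only: distrib_right mult.assoc)
  then have "K ((a + x) mod p) - K a - x * (q * r)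
     = (K ((a + x) mod p) - K a - ((a + x) mod p - a) * (q * r)) - p * (d * (q * r))"
    by linarith
  moreover have "p dvd \<dots>"
    by (rule dvd_diff[OF K_diff_mod[OF assms sh_range]]) simp
  ultimately show ?thesis by (simp only:)
qed

section \<open>Box shifts and good transitions\<close>

text \<open>
  A difference \<open>D\<close> of two \<open>K\<close>-values with digit shift \<open>x\<close> for which the other two digits move by
  less than the side lengths of the box.
\<close>
definition box_shift :: "int \<Rightarrow> int \<Rightarrow> bool" where
  "box_shift x D \<longleftrightarrow> (\<exists>f g. \<bar>f\<bar> < q - B \<and> \<bar>g\<bar> < r - C \<and> x * (q * r) + f * (p * r) + g * (p * q) = D)"

lemma box_mult:
  shows "\<bar>f\<bar> < q - B \<Longrightarrow> \<bar>f * (p * r)\<bar> \<le> t * (q * r) + r - p * r"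
    and "\<bar>g\<bar> < r - C \<Longrightarrow> \<bar>g * (p * q)\<bar> \<le> s * (q * r) + q - p * q"
proof -
  assume f: "\<bar>f\<bar> < q - B"
  have "\<bar>f * (p * r)\<bar> = \<bar>f\<bar> * (p * r)" using pos by (simp add: abs_mult)
  also have "\<dots> \<le> (q - B - 1) * (p * r)" using f pos by (intro mult_right_mono) auto
  also have "\<dots> = p * q * r - B * (p * r) - p * r" by (simp add: algebra_simps)
  finally show "\<bar>f * (p * r)\<bar> \<le> t * (q * r) + r - p * r" using tB' by linarith
next
  assume f: "\<bar>g\<bar> < r - C"
  have "\<bar>g * (p * q)\<bar> = \<bar>g\<bar> * (p * q)" using pos by (simp add: abs_mult)
  also have "\<dots> \<le> (r - C - 1) * (p * q)" using f pos by (intro mult_right_mono) auto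
  also have "\<dots> = p * q * r - C * (p * q) - p * q" by (simp add: algebra_simps)
  finally show "\<bar>g * (p * q)\<bar> \<le> s * (q * r) + q - p * q" using sC' by linarith
qed

text \<open>Both ends lie in the box, so \<open>b\<close> and \<open>c\<close> move by less than its
  sides. The wrap of \<open>a\<close> and the change of carry leave a multiple of
  \<open>p * q * r\<close>, which the range of \<open>x\<close> forces to be zero.\<close>

lemma high_box_shift:
  assumes a: "0 \<le> a" "a < p" "B \<le> b a" "C \<le> c a" and a': "0 \<le> a'" "a' < p" "B \<le> b a'" "C \<le> c a'"
    and sh: "a' = (a + x) mod p" and x: "t \<le> x" "x \<le> p - s - t"
  shows "box_shift x (K a' - K a)"
proof -
  define f g where "f = b a' - b a" and "g = c a' - c a"
  have f: "\<bar>f\<bar> < q - B" and g: "\<bar>g\<bar> < r - C"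
    using b[OF a(1,2)] b[OF a'(1,2)] c[OF a(1,2)] c[OF a'(1,2)] a a' unfolding f_def g_def by linarith+
  obtain d where d: "x = a' - a + p * d"
    by (rule that[of "(a + x) div p"]) (unfold sh, simp add: minus_mult_div_eq_mod[symmetric])
  have "x * (q * r) + f * (p * r) + g * (p * q) = K a' - K a + (S a' - S a + d) * (p * q * r)"
    using F[OF a(1,2)] F[OF a'(1,2)] unfolding f_def g_def d by (simp add: algebra_simps)
  then obtain j where j: "x * (q * r) + f * (p * r) + g * (p * q) = K a' - K a + j * (p * q * r)" by blast
  have xQ: "t * (q * r) \<le> x * (q * r)" "x * (q * r) \<le> (p - s - t) * (q * r)"
    using x pos by (auto intro!: mult_right_mono)
  have xQ': "x * (q * r) \<le> p * q * r - s * (q * r) - t * (q * r)"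
    using xQ(2) by (simp add: left_diff_distrib mult.assoc)
  have sp: "s * (q * r) \<le> p * q * r" using mult_right_mono[of s p "q * r"] s1 st stp pos by (simp add: mult.assoc)
  note * = box_mult(1)[OF f] box_mult(2)[OF g] K_diff_lt[OF a(1,2) a'(1,2)] sum_lt_products xQ(1) xQ' sp pos
  have "j * (p * q * r) < 1 * (p * q * r)" "(-1) * (p * q * r) < j * (p * q * r)" using j * by linarith+
  then have "j < 1" "-1 < j" using pos(7) by (simp_all only: mult_less_cancel_right_pos)
  then have "j = 0" by simp
  then show ?thesis unfolding box_shift_def using f g j by auto
qed

text \<open>If \<open>f\<close> or \<open>g\<close> were nonnegative, the term in \<open>x\<close>
  would outweigh the remaining negative term by more than \<open>p\<close>.\<close>

lemma box_shift_neg: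
  assumes "\<bar>f\<bar> < q - B" "\<bar>g\<bar> < r - C" "x * (q * r) + f * (p * r) + g * (p * q) = D"
    and x: "t \<le> x" and D: "\<bar>D\<bar> < p"
  shows "f < 0" "g < 0"
proof -
  have xQ: "t * (q * r) \<le> x * (q * r)" using x pos by (auto intro!: mult_right_mono)
  have stQ: "s * (q * r) \<le> t * (q * r)" using st pos by (intro mult_right_mono) auto
  have "2 * r \<le> p * r" "2 * q \<le> p * q" using p2 pos by auto
  then have "f * (p * r) < 0 * (p * r)" "g * (p * q) < 0 * (p * q)"
    using box_mult(1)[OF assms(1)] box_mult(2)[OF assms(2)] assms(3) D xQ stQ pq pr pos by linarith+
  then show "f < 0" "g < 0" using pos(5,6) by (simp_all only: mult_less_cancel_right_pos)
qed

text \<open>The transitions along the cycle \<open>U \<rightarrow> L \<rightarrow> E \<rightarrow> U\<close> of carries 0, 1, 2.\<close>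
definition good :: "int \<Rightarrow> int \<Rightarrow> bool" where
  "good x a \<longleftrightarrow> (a \<in> U \<and> a + x \<in> L) \<or> (a \<in> L \<and> a + x \<in> E) \<or> (a \<in> E \<and> a + x - p \<in> U)"

lemma good_range: "good x a \<Longrightarrow> 0 \<le> a \<and> a < p" unfolding good_def using in_range by blast

lemma good_sh:
  "a \<in> U \<Longrightarrow> a + x \<in> L \<Longrightarrow> (a + x) mod p = a + x"
  "a \<in> L \<Longrightarrow> a + x \<in> E \<Longrightarrow> (a + x) mod p = a + x"
  "a \<in> E \<Longrightarrow> a + x - p \<in> U \<Longrightarrow> (a + x) mod p = a + x - p"
proof -
  show "a \<in> U \<Longrightarrow> a + x \<in> L \<Longrightarrow> (a + x) mod p = a + x" using in_range(3)[of "a + x"] by simp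
  show "a \<in> L \<Longrightarrow> a + x \<in> E \<Longrightarrow> (a + x) mod p = a + x" using in_range(5)[of "a + x"] by simp
  show "a \<in> E \<Longrightarrow> a + x - p \<in> U \<Longrightarrow> (a + x) mod p = a + x - p"
    using in_range(1)[of "a + x - p"] mod_pos_pos_trivial[of "a + x - p" p] minus_mod_self2[of "a + x" p] by linarith
qed

text \<open>
  A box shift with \<open>t \<le> x\<close> lowers \<open>b\<close> and \<open>c\<close> by less than the box size, so the wrap-arounds needed
  to change the carry would put a digit into the box, keep it out of the box, or cannot occur at all.
\<close>
lemma good_not_box_shift:
  assumes g: "good x a" and x: "t \<le> x"
  shows "\<not> box_shift x (K ((a + x) mod p) - K a)"
proof
  assume "box_shift x (K ((a + x) mod p) - K a)"
  then obtain f g where fg: "\<bar>f\<bar> < q - B" "\<bar>g\<bar> < r - C"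
    "x * (q * r) + f * (p * r) + g * (p * q) = K ((a + x) mod p) - K a" unfolding box_shift_def by auto
  define a' where "a' = (a + x) mod p"
  have ra: "0 \<le> a" "a < p" using good_range[OF g] by auto
  have ra': "0 \<le> a'" "a' < p" unfolding a'_def using sh_range by auto
  note ba = b[OF ra] c[OF ra] b[OF ra'] c[OF ra']
  have fg0: "f < 0" "g < 0" using box_shift_neg[OF fg x] K_diff_lt[OF ra ra'] unfolding a'_def by auto
  have eq: "(a' - a - x) * (q * r) + (b a' - b a - f) * (p * r) + (c a' - c a - g) * (p * q) = (S a' - S a) * (p * q * r)"
    using F[OF ra] F[OF ra'] fg(3) unfolding a'_def[symmetric] by (simp add: algebra_simps)
  \<comment> \<open>\<open>w\<close>, \<open>i\<close> and \<open>j\<close> count the wraps of the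
    three digits; their sum is the change of the carry.\<close>
  obtain w where w: "a' - a - x = p * w" and wdef: "w = - ((a + x) div p)"
    unfolding a'_def by (simp add: minus_mult_div_eq_mod[symmetric])
  have "q dvd (b a' - b a - f) * (p * r)"
  proof -
    have "(b a' - b a - f) * (p * r) = q * ((S a' - S a) * (p * r) - (c a' - c a - g) * p - (a' - a - x) * r)"
      using eq by (simp add: algebra_simps)
    then show ?thesis by simp
  qed
  moreover have "coprime q (p * r)" using cop by (simp add: coprime_commute)
  ultimately obtain i where i: "b a' - b a - f = q * i" by (auto simp: coprime_dvd_mult_left_iff)
  have "r dvd (c a' - c a - g) * (p * q)"
  proof -
    have "(c a' - c a - g) * (p * q) = r * ((S a' - S a) * (p * q) - (b a' - b a - f) * p - (a' - a - x) * q)"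
      using eq by (simp add: algebra_simps)
    then show ?thesis by simp
  qed
  moreover have "coprime r (p * q)" using cop by (simp add: coprime_commute)
  ultimately obtain j where j: "c a' - c a - g = r * j" by (auto simp: coprime_dvd_mult_left_iff)
  have "(w + i + j) * (p * q * r) = (S a' - S a) * (p * q * r)"
    using eq unfolding w i j by (simp add: algebra_simps)
  then have ij: "w + i + j = S a' - S a" using pos by simp
  have fB: "- f < q - B" "- g < r - C" using fg(1,2) by auto
  have im: "i \<ge> 1 \<Longrightarrow> q \<le> q * i" "j \<ge> 1 \<Longrightarrow> r \<le> r * j" "i \<le> -1 \<Longrightarrow> q * i \<le> - q" "j \<le> -1 \<Longrightarrow> r * j \<le> - r"
    "i \<le> 0 \<Longrightarrow> q * i \<le> 0" "j \<le> 0 \<Longrightarrow> r * j \<le> 0"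
    using pos mult_left_mono[of i "-1" q] mult_left_mono[of j "-1" r]
      by (auto simp: mult_le_0_iff)
  from g[unfolded good_def] consider (UL) "a \<in> U" "a + x \<in> L" | (LE) "a \<in> L" "a + x \<in> E"
    | (EU) "a \<in> E" "a + x - p \<in> U" by blast
  then show False
  proof cases
    case UL
    have a': "a' = a + x" unfolding a'_def using good_sh(1)[OF UL] .
    have "S a' = 1" "b a' < B" "c a' < C" "S a = 0" using UL a' unfolding L_def U_def by auto
    moreover have "w = 0" using w a' pos by auto
    ultimately have "i + j = 1" using ij by simp
    then have "i \<ge> 1 \<or> j \<ge> 1" by linarith
    then show False using im(1,2) i j fB ba \<open>b a' < B\<close> \<open>c a' < C\<close> by linarith
  next
    case LE
    have a': "a' = a + x" unfolding a'_def using good_sh(2)[OF LE] .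
    have "S a' = 2" "B \<le> b a'" "C \<le> c a'" "S a = 1" "b a < B" "c a < C"
      using LE a' E_S unfolding L_def E_def by auto
    moreover have "w = 0" using w a' pos by auto
    ultimately have "i + j = 1" using ij by simp
    then have "i \<le> 0 \<or> j \<le> 0" by linarith
    then show False using im(5,6) i j fg0 \<open>b a < B\<close> \<open>c a < C\<close> \<open>B \<le> b a'\<close> \<open>C \<le> c a'\<close> by linarith
  next
    case EU
    have a': "a' = a + x - p" unfolding a'_def using good_sh(3)[OF EU] .
    have "S a' = 0" "S a = 2" using EU a' E_S unfolding U_def by auto
    moreover have "p * (w + 1) = 0" using w a' by (simp add: algebra_simps)
    then have "w = -1" using pos by auto
    ultimately have "i + j = -1" using ij by simp
    then have "i \<le> -1 \<or> j \<le> -1" by linarith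
    then show False using im(3,4) i j fg0 ba by linarith
  qed
qed

end

section \<open>Windows with an excessive sum\<close>

text \<open>An excessive sum leaves at most \<open>e\<close> digits of \<open>{s + t..<p}\<close>
  outside \<open>E\<close>. By \<open>top\<close>, \<open>E\<close> then has a member to which
  \<open>H_in_box_if\<close> applies.\<close>

locale ternary_excess = ternary_window +
  fixes e :: int
  assumes e0: "0 \<le> e" and et: "e < t" and card_E_ge: "p - s - t - int (card E) \<le> e" and top: "s + 2 * t + e < p"
begin

lemma E_near_top: "\<exists>a\<in>E. s + 2 * t \<le> a"
proof (rule ccontr)
  assume "\<not> ?thesis"
  then have "E \<subseteq> {s + t..<s + 2 * t}" using region_subset(5) by force
  then have "card E \<le> card {s + t..<s + 2 * t}" by (intro card_mono) auto
  then show False using card_E_ge top s1 st by simp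
qed

lemma H_in_box: "a \<in> H \<Longrightarrow> B \<le> b a \<and> C \<le> c a" using E_near_top H_in_box_if by blast

definition X where "X = E \<union> G \<union> H"

lemma X_in_box:
  assumes "a \<in> X" shows "0 \<le> a \<and> a < p \<and> B \<le> b a \<and> C \<le> c a"
proof -
  from assms consider "a \<in> E" | "a \<in> G" | "a \<in> H" unfolding X_def by blast
  then show ?thesis
  proof cases
    case 1 then show ?thesis using in_range(5)[OF 1] by (simp add: E_def)
  next
    case 2 then show ?thesis using in_range(2)[OF 2] by (simp add: G_def)
  next
    case 3 then show ?thesis using in_range(4)[OF 3] H_in_box[OF 3] by simp
  qed
qed

lemma finite_X [simp]: "finite X" unfolding X_def by simp

lemma card_X: "int (card X) = int (card E) + card G + card H"
proof -
  have "E \<inter> G = {}" "(E \<union> G) \<inter> H = {}" using in_range(2,4,5) s1 st by force+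
  then show ?thesis unfolding X_def by (simp add: card_Un_disjoint)
qed

text \<open>The budget of missing digits on which the pigeonhole arguments below draw.\<close>

lemma card_lost:
  assumes "Z \<subseteq> {s + t..<p}" "Z \<inter> E = {}" shows "int (card Z) \<le> e"
proof -
  have fZ: "finite Z" using assms(1) finite_subset by blast
  have "card (E \<union> Z) \<le> card {s + t..<p}" using assms region_subset(5) by (intro card_mono) auto
  moreover have "card (E \<union> Z) = card E + card Z" using assms fZ by (intro card_Un_disjoint) auto
  ultimately show ?thesis using card_E_ge stp by simp
qed

text \<open>The upper bound leaves room in \<open>{s + t..<p}\<close> for \<open>e + 1\<close> pairs
  \<open>a\<close>, \<open>a + x\<close>, one more than the missing digits can spoil; the lower
  bound is what the box shift lemmas require.\<close>

definition admissible where "admissible x \<longleftrightarrow> t \<le> x \<and> x + s + t + e < p"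

lemma admissible_pair:
  assumes "admissible x" shows "\<exists>a\<in>E. a + x \<in> E"
proof (rule ccontr)
  assume no: "\<not> ?thesis"
  \<comment> \<open>\<open>h\<close> picks from each pair \<open>a\<close>, \<open>a + x\<close> a
    member outside \<open>E\<close>. The pairs are disjoint as \<open>e < x\<close>, so
    \<open>e + 1\<close> digits would be missing.\<close>
  define h where "h a = (if a \<in> E then a + x else a)" for a
  let ?A = "{s + t..s + t + e}"
  have x: "e < x" "x + s + t + e < p" using assms et unfolding admissible_def by auto
  have inj: "inj_on h ?A" unfolding inj_on_def h_def using x by auto
  have "h ` ?A \<subseteq> {s + t..<p}" unfolding h_def using x e0 by auto
  moreover have "h ` ?A \<inter> E = {}" unfolding h_def using no by auto
  ultimately have "int (card (h ` ?A)) \<le> e" by (rule card_lost)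
  then show False using card_image[OF inj] e0 by simp
qed

lemma admissible_bounds: "admissible x \<Longrightarrow> t \<le> x \<and> x \<le> p - s - t \<and> 0 < x \<and> x < p"
  unfolding admissible_def using e0 s1 st by auto

text \<open>
  \<open>K ((a + x) mod p) - K a\<close> is one of two integers that differ by \<open>p\<close>; for admissible \<open>x\<close> one of
  them is a box shift, so good transitions realize the other one.
\<close>
definition good_shift where "good_shift x = (SOME D. \<forall>a. good x a \<longrightarrow> K ((a + x) mod p) - K a = D)"

lemma good_shift_eq:
  assumes x: "admissible x" and g: "good x a"
  shows "K ((a + x) mod p) - K a = good_shift x"
proof -
  obtain a1 where a1: "a1 \<in> E" "a1 + x \<in> E" using admissible_pair[OF x] by blast
  then have r1: "0 \<le> a1" "a1 < p" "B \<le> b a1" "C \<le> c a1" "0 \<le> a1 + x" "a1 + x < p" "B \<le> b (a1 + x)" "C \<le> c (a1 + x)"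
    using X_in_box[of a1] X_in_box[of "a1 + x"] by (simp_all add: X_def)
  define D1 where "D1 = K ((a1 + x) mod p) - K a1"
  have m1: "(a1 + x) mod p = a1 + x" using r1 by simp
  have box_shift: "box_shift x D1" unfolding D1_def m1 using high_box_shift[OF r1(1-8) m1[symmetric]] admissible_bounds[OF x] by blast
  have D1p: "\<bar>D1\<bar> < p" unfolding D1_def using K_diff_lt[OF r1(1,2) sh_range] .
  have *: "K ((a + x) mod p) - K a = (if 0 < D1 then D1 - p else D1 + p)" if "good x a" for a
  proof -
    define D where "D = K ((a + x) mod p) - K a"
    have r: "0 \<le> a" "a < p" using good_range[OF that] by auto
    have "D \<noteq> D1" using good_not_box_shift[OF that] admissible_bounds[OF x] box_shift unfolding D_def by auto
    moreover have "\<bar>D\<bar> < p" unfolding D_def using K_diff_lt[OF r sh_range] .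
    moreover have "p dvd D - D1"
      using dvd_diff[OF K_sh_mod[OF r, of x] K_sh_mod[OF r1(1,2), of x]] unfolding D_def D1_def by (simp add: algebra_simps)
    then obtain k where k: "D = D1 + p * k" by (auto simp: dvd_def algebra_simps)
    have "k < 2"
    proof (rule ccontr)
      assume "\<not> k < 2"
      then have "p * 2 \<le> p * k" using pos by (intro mult_left_mono) auto
      then show False using k D1p \<open>\<bar>D\<bar> < p\<close> by linarith
    qed
    moreover have "- 2 < k"
    proof (rule ccontr)
      assume "\<not> - 2 < k"
      then have "p * k \<le> p * (- 2)" using pos by (intro mult_left_mono) auto
      then show False using k D1p \<open>\<bar>D\<bar> < p\<close> by linarith
    qed
    ultimately have "k = 1 \<or> k = -1" using k by force
    then show ?thesis using k \<open>\<bar>D\<bar> < p\<close> D1p unfolding D_def by auto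
  qed
  have "\<forall>a. good x a \<longrightarrow> K ((a + x) mod p) - K a = good_shift x"
    unfolding good_shift_def by (rule someI[of _ "if 0 < D1 then D1 - p else D1 + p"]) (use * in blast)
  then show ?thesis using g by blast
qed

lemma good_facts:
  assumes x: "admissible x" and g: "good x a"
  shows "good_shift x \<noteq> 0" "\<bar>good_shift x\<bar> < p" "\<not> box_shift x (good_shift x)" "p dvd good_shift x - x * (q * r)"
proof -
  have r: "0 \<le> a" "a < p" using good_range[OF g] by auto
  show "\<bar>good_shift x\<bar> < p" using K_diff_lt[OF r sh_range[of a x]] good_shift_eq[OF x g] by simp
  show "\<not> box_shift x (good_shift x)" using good_not_box_shift[OF g] admissible_bounds[OF x] good_shift_eq[OF x g] by simp
  show "p dvd good_shift x - x * (q * r)" using K_sh_mod[OF r, of x] good_shift_eq[OF x g] by simp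
  show "good_shift x \<noteq> 0"
  proof
    assume "good_shift x = 0"
    then have "(a + x) mod p = a" using good_shift_eq[OF x g] K_inj[OF sh_range r, of a x] by simp
    then have "(a + x) mod p = a mod p" using r by simp
    then have "p dvd x" by (simp add: mod_eq_dvd_iff)
    then show False using admissible_bounds[OF x] zdvd_imp_le by fastforce
  qed
qed

text \<open>Inclusion-exclusion for \<open>U\<close> and the translate of \<open>L\<close> by
  \<open>- x\<close>, both inside \<open>{t - x..<s}\<close>.\<close>

lemma card_UL:
  assumes "t \<le> x" shows "int (card U) + card L \<le> s + (x - t) + card {a \<in> U. a + x \<in> L}"
proof -
  let ?L = "(\<lambda>a. a - x) ` L"
  have "card ?L = card L" by (intro card_image) (auto simp: inj_on_def)
  moreover have "U \<inter> ?L = {a \<in> U. a + x \<in> L}" by force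
  moreover have "card (U \<union> ?L) \<le> card {t - x..<s}"
    using in_range(1,3) assms by (intro card_mono) force+
  moreover have "card U + card ?L = card (U \<union> ?L) + card (U \<inter> ?L)" by (intro card_Un_Int) auto
  ultimately show ?thesis using s1 assms by simp
qed

text \<open>By \<open>card_UL\<close> more than \<open>e\<close> digits step from \<open>U\<close>
  into \<open>L\<close>, and at most \<open>e\<close> of them can miss \<open>E\<close>
  afterwards.\<close>

lemma ULE_chain:
  assumes x: "t \<le> x" and y: "t \<le> y" "y \<le> p - s - t"
    and UL: "s + (x - t) + e < int (card U) + card L"
  shows "\<exists>a. a \<in> U \<and> a + x \<in> L \<and> a + x + y \<in> E"
proof (rule ccontr)
  assume no: "\<not> ?thesis"
  let ?P = "{a \<in> U. a + x \<in> L}"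
  let ?Z = "(\<lambda>a. a + x + y) ` ?P"
  have "?Z \<subseteq> {s + t..<p}" using in_range(3) y st by force
  moreover have "?Z \<inter> E = {}" using no by auto
  ultimately have "int (card ?Z) \<le> e" by (rule card_lost)
  moreover have "card ?Z = card ?P" by (intro card_image) (auto simp: inj_on_def)
  ultimately show False using card_UL[OF x] UL by simp
qed

text \<open>After total shift \<open>p\<close> the chain is back at its first digit, so the three
  differences telescope.\<close>

lemma good_shift_sum:
  assumes x: "admissible x" and y: "admissible y" and z: "admissible z" and xyz: "x + y + z = p"
    and UL: "s + (x - t) + e < int (card U) + card L"
  shows "good_shift x + good_shift y + good_shift z = 0"
proof -
  obtain a where a: "a \<in> U" "a + x \<in> L" "a + x + y \<in> E"
    using ULE_chain[OF _ _ _ UL, of y] admissible_bounds[OF x] admissible_bounds[OF y] by auto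
  have z': "a + x + y + z - p = a" using xyz by simp
  have g: "good x a" "good y (a + x)" "good z (a + x + y)"
    unfolding good_def z' using a by blast+
  have m: "(a + x) mod p = a + x" "(a + x + y) mod p = a + x + y" "(a + x + y + z) mod p = a"
    using good_sh(1)[OF a(1,2)] good_sh(2)[OF a(2,3)] good_sh(3)[of "a + x + y" z] a z' by auto
  show ?thesis using good_shift_eq[OF x g(1)] good_shift_eq[OF y g(2)] good_shift_eq[OF z g(3)] unfolding m by simp
qed

lemma good_exists:
  assumes x: "admissible x" and y: "t \<le> y" and UL: "s + (y - t) + e < int (card U) + card L"
  shows "\<exists>a. good x a"
proof -
  obtain a where a: "a \<in> U" "a + y \<in> L" "a + y + x \<in> E"
    using ULE_chain[OF y _ _ UL, of x] admissible_bounds[OF x] by auto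
  then have "good x (a + y)" unfolding good_def by auto
  then show ?thesis by blast
qed

section \<open>Counting good digits and box digits\<close>

text \<open>\<open>K\<close> is injective, and both \<open>K a\<close> and \<open>K a + D\<close>
  must lie in the same window of \<open>p\<close> integers.\<close>

lemma card_diff_le:
  assumes "\<bar>D\<bar> < p" shows "int (card {a \<in> {0..<p}. K ((a + x) mod p) - K a = D}) \<le> p - \<bar>D\<bar>"
proof -
  let ?A = "{a \<in> {0..<p}. K ((a + x) mod p) - K a = D}"
  have inj: "inj_on K ?A" using K_inj unfolding inj_on_def by auto
  have "K ` ?A \<subseteq> {max (n - p + 1) (n - p + 1 - D)..min n (n - D)}"
  proof
    fix k assume "k \<in> K ` ?A"
    then obtain a where a: "k = K a" "0 \<le> a" "a < p" "K ((a + x) mod p) = k + D" by auto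
    show "k \<in> {max (n - p + 1) (n - p + 1 - D)..min n (n - D)}"
      using K[OF a(2,3)] K[OF sh_range, of a x] a(1,4) by auto
  qed
  then have "card (K ` ?A) \<le> card {max (n - p + 1) (n - p + 1 - D)..min n (n - D)}"
    by (intro card_mono) auto
  moreover have "int (card {max (n - p + 1) (n - p + 1 - D)..min n (n - D)}) = p - \<bar>D\<bar>"
    using assms p2 by (auto simp: max_def min_def abs_if)
  ultimately show ?thesis using card_image[OF inj] by linarith
qed

lemma good_set: "{a. good x a} = {a \<in> U. a + x \<in> L} \<union> {a \<in> L. a + x \<in> E} \<union> {a \<in> E. a + x - p \<in> U}"
  unfolding good_def by auto

text \<open>The three kinds of good digits are disjoint: \<open>card_UL\<close> counts the first,
  and all but \<open>e\<close> digits of \<open>L\<close> and of \<open>U\<close> yield the other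
  two.\<close>

lemma card_good:
  assumes x: "t \<le> x" "x \<le> p - s - t"
  shows "2 * int (card U) + 2 * card L - s - (x - t) - 2 * e \<le> card {a. good x a}"
proof -
  let ?P1 = "{a \<in> U. a + x \<in> L}" and ?P2 = "{a \<in> L. a + x \<in> E}" and ?P3 = "{a \<in> E. a + x - p \<in> U}"
  have dis: "?P1 \<inter> ?P2 = {}" "(?P1 \<union> ?P2) \<inter> ?P3 = {}" using in_range(1,3,5) st s1 by force+
  have finite_region: "finite ?P1" "finite ?P2" "finite ?P3" by (auto intro: rev_finite_subset)
  have c: "card {a. good x a} = card ?P1 + card ?P2 + card ?P3"
    unfolding good_set using dis finite_region by (simp add: card_Un_disjoint)
  have 2: "int (card L) \<le> card ?P2 + e"
  proof -
    let ?N = "{a \<in> L. a + x \<notin> E}"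
    have "int (card ((\<lambda>a. a + x) ` ?N)) \<le> e"
      by (rule card_lost) (use in_range(3) x st in force)+
    moreover have "card ((\<lambda>a. a + x) ` ?N) = card ?N" by (intro card_image) (auto simp: inj_on_def)
    moreover have "card L = card ?P2 + card ?N"
      by (subst card_Un_disjoint[symmetric]) (auto intro: rev_finite_subset arg_cong[of _ _ card])
    ultimately show ?thesis by simp
  qed
  have 3: "int (card U) \<le> card ?P3 + e"
  proof -
    let ?N = "{a \<in> U. a - x + p \<notin> E}"
    have "int (card ((\<lambda>a. a - x + p) ` ?N)) \<le> e"
      by (rule card_lost) (use in_range(1) x st in force)+
    moreover have "card ((\<lambda>a. a - x + p) ` ?N) = card ?N" by (intro card_image) (auto simp: inj_on_def)
    moreover have "?P3 = (\<lambda>a. a - x + p) ` {a \<in> U. a - x + p \<in> E}" by force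
    then have "card ?P3 = card {a \<in> U. a - x + p \<in> E}" by (simp add: card_image inj_on_def)
    moreover have "card U = card {a \<in> U. a - x + p \<in> E} + card ?N"
      by (subst card_Un_disjoint[symmetric]) (auto intro: rev_finite_subset arg_cong[of _ _ card])
    ultimately show ?thesis by simp
  qed
  show ?thesis using card_UL[OF x(1)] 2 3 c by simp
qed

lemma good_sub: 
  assumes "\<And>a. good x a \<Longrightarrow> K ((a + x) mod p) - K a = D"
  shows "{a. good x a} \<subseteq> {a \<in> {0..<p}. K ((a + x) mod p) - K a = D}"
  using assms good_range by auto

text \<open>All good digits share one difference, so its size limits their number.\<close>

lemma good_shift_bound:
  assumes x: "admissible x" and g: "good x a"
  shows "2 * int (card U) + 2 * card L \<le> p - \<bar>good_shift x\<bar> + s + (x - t) + 2 * e"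
proof -
  have "card {a. good x a} \<le> card {a \<in> {0..<p}. K ((a + x) mod p) - K a = good_shift x}"
    by (rule card_mono[OF _ good_sub])
      (use good_shift_eq[OF x] in \<open>auto intro: finite_subset[of _ "{0..<p}"]\<close>)
  then show ?thesis
    using card_diff_le[OF good_facts(2)[OF x g], of x] card_good[of x] admissible_bounds[OF x] by simp
qed

text \<open>Two box digits with this difference would be related by the digit shift
  \<open>x\<close>, and \<open>D\<close> would be a box shift.\<close>

lemma X_diff:
  assumes x: "t \<le> x" "x \<le> p - s - t" and D: "\<not> box_shift x D" "p dvd D - x * (q * r)" and a: "a \<in> X" "a' \<in> X"
  shows "K a' - K a \<noteq> D"
proof
  assume eq: "K a' - K a = D"
  have r: "0 \<le> a" "a < p" "B \<le> b a" "C \<le> c a" "0 \<le> a'" "a' < p" "B \<le> b a'" "C \<le> c a'" using X_in_box a by auto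
  have "a' = (a + x) mod p" by (rule shift_of_K_diff) (use r D eq in auto)
  from high_box_shift[OF r this x] D eq show False by simp
qed

text \<open>
  The image of \<open>X\<close> and its translates by \<open>w\<close> and \<open>2 * w\<close> are disjoint in an interval of length
  \<open>p + 2 * w\<close>; \<open>Z\<close> collects points that they miss.
\<close>
lemma X_cover:
  assumes w: "0 < w" and d1: "\<And>a a'. a \<in> X \<Longrightarrow> a' \<in> X \<Longrightarrow> K a' - K a \<noteq> w"
    and d2: "\<And>a a'. a \<in> X \<Longrightarrow> a' \<in> X \<Longrightarrow> K a' - K a \<noteq> 2 * w"
    and Z: "Z \<subseteq> {n - p + 1..n + 2 * w}" "\<And>k. k \<in> Z \<Longrightarrow> k \<notin> K ` X \<and> k - w \<notin> K ` X \<and> k - 2 * w \<notin> K ` X"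
  shows "3 * int (card X) + card Z \<le> p + 2 * w"
proof -
  let ?Y = "K ` X" and ?Y1 = "(\<lambda>k. k + w) ` K ` X" and ?Y2 = "(\<lambda>k. k + 2 * w) ` K ` X"
  have inj: "inj_on K X" using K_inj X_in_box unfolding inj_on_def by blast
  have card: "card ?Y = card X" "card ?Y1 = card X" "card ?Y2 = card X"
    using card_image[OF inj] by (simp_all add: card_image)
  have fZ: "finite Z" using Z(1) finite_subset by blast
  have dis: "?Y \<inter> ?Y1 = {}" "(?Y \<union> ?Y1) \<inter> ?Y2 = {}"
    using d1 d2 by (fastforce simp: algebra_simps)+
  have disZ: "(?Y \<union> ?Y1 \<union> ?Y2) \<inter> Z = {}" using Z(2) by force
  have "card (?Y \<union> ?Y1 \<union> ?Y2 \<union> Z) = 3 * card X + card Z"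
    using dis disZ fZ card by (simp add: card_Un_disjoint)
  moreover have "?Y \<union> ?Y1 \<union> ?Y2 \<union> Z \<subseteq> {n - p + 1..n + 2 * w}"
  proof -
    have "n - p + 1 \<le> K a \<and> K a \<le> n" if "a \<in> X" for a using K[of a] X_in_box[OF that] by auto
    then show ?thesis using w Z(1) by fastforce
  qed
  then have "card (?Y \<union> ?Y1 \<union> ?Y2 \<union> Z) \<le> card {n - p + 1..n + 2 * w}" by (intro card_mono) auto
  ultimately show ?thesis using w p2 by simp
qed

lemma X_bound:
  assumes w: "0 < w" and x: "t \<le> x" "x \<le> p - s - t" "\<not> box_shift x D" "p dvd D - x * (q * r)" "\<bar>D\<bar> = w"
    and y: "t \<le> y" "y \<le> p - s - t" "\<not> box_shift y D'" "p dvd D' - y * (q * r)" "\<bar>D'\<bar> = 2 * w"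
    and Z: "Z \<subseteq> {n - p + 1..n + 2 * w}" "\<And>k. k \<in> Z \<Longrightarrow> k \<notin> K ` X \<and> k - w \<notin> K ` X \<and> k - 2 * w \<notin> K ` X"
  shows "3 * int (card X) + card Z \<le> p + 2 * w"
proof (rule X_cover[OF w _ _ Z])
  fix a a' assume "a \<in> X" "a' \<in> X"
  then have "K a' - K a \<noteq> D" "K a - K a' \<noteq> D" "K a' - K a \<noteq> D'" "K a - K a' \<noteq> D'"
    using X_diff[OF x(1-4)] X_diff[OF y(1-4)] by auto
  then show "K a' - K a \<noteq> w" "K a' - K a \<noteq> 2 * w" using x(5) y(5) by linarith+
qed

section \<open>Excluding an excess, by the residue of \<open>p\<close> modulo 3\<close>

text \<open>Three times the size of \<open>X\<close> is at most \<open>p + 2 * w\<close>, and twice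
  that of \<open>U\<close> and \<open>L\<close> together at most \<open>p - 2 * w + s\<close>; in
  the sum \<open>w\<close> cancels. The third copy of \<open>U\<close> and \<open>L\<close> costs at
  most \<open>2 * s\<close>.\<close>

lemma excess_bound:
  assumes x: "admissible x" "good x ax" and y: "admissible y" "good y ay" and tt: "admissible t" "good t a'"
    and w: "\<bar>good_shift x\<bar> = w" "\<bar>good_shift y\<bar> = 2 * w" "2 * w + 2 * e \<le> \<bar>good_shift t\<bar>"
  shows "3 * (int (card U) + card G + card E + card L + card H - s) \<le> 2 * p"
proof -
  note gx = good_facts[OF x] and gy = good_facts[OF y]
  have "3 * int (card X) + card ({} :: int set) \<le> p + 2 * w"
    by (rule X_bound[where x = x and y = y and D = "good_shift x" and D' = "good_shift y"])
      (use gx gy admissible_bounds[OF x(1)] admissible_bounds[OF y(1)] w in auto)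
  then show ?thesis using card_X card_regions good_shift_bound[OF tt] w(3) by simp
qed

text \<open>Cycles of three shifts with sum \<open>p\<close>, beginning with \<open>m\<close>,
  \<open>m + 1\<close>, \<open>m + 1\<close>, express the good shifts from \<open>t\<close> to
  \<open>m + 1 + e\<close> as multiples of \<open>d\<close>. At \<open>t\<close> the factor is
  \<open>3 * e + 2\<close> in absolute value, enough for \<open>excess_bound\<close>.\<close>

lemma excess_bound_mod2:
  assumes p: "p = 3 * m + 2" and e: "e = m - t" and UL: "2 * m + 2 - t \<le> int (card U) + card L"
  shows "3 * (int (card U) + card G + card E + card L + card H - s) \<le> 2 * p"
proof -
  define d where "d = good_shift (m + 1)"
  have adm1: "admissible (m - i)" "admissible (m + 1 + i)" if "0 \<le> i" "i \<le> e" for i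
    using that p e st s1 e0 unfolding admissible_def by auto
  have ul: "s + (m - i - t) + e < int (card U) + card L" if "0 \<le> i" "i \<le> e" for i
    using that p e st s1 e0 UL by auto
  have dm: "good_shift m = - (2 * d)"
    using good_shift_sum[OF adm1(1)[of 0] adm1(2)[of 0] adm1(2)[of 0] _ ul[of 0]] p e0 unfolding d_def by simp
  have P: "int i \<le> e \<Longrightarrow> good_shift (m - int i) = - ((3 * int i + 2) * d) \<and> good_shift (m + 1 + int i) = (3 * int i + 1) * d" for i
  proof (induction i)
    case 0 then show ?case using dm d_def by simp
  next
    case (Suc i)
    then have i: "0 \<le> int i" "int i \<le> e" "0 \<le> int i + 1" "int i + 1 \<le> e" by auto
    have IH: "good_shift (m - int i) = - ((3 * int i + 2) * d)" "good_shift (m + 1 + int i) = (3 * int i + 1) * d"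
      using Suc by auto
    \<comment> \<open>The cycle \<open>m - i\<close>, \<open>m\<close>, \<open>m + 2 + i\<close>
      yields the next larger shift; then \<open>m - i - 1\<close>, \<open>m + 1\<close>,
      \<open>m + 2 + i\<close> yields the next smaller one.\<close>
    have 1: "good_shift (m - int i) + good_shift (m - 0) + good_shift (m + 1 + (int i + 1)) = 0"
      by (rule good_shift_sum[OF adm1(1)[OF i(1,2)] adm1(1)[of 0] adm1(2)[OF i(3,4)] _ ul[OF i(1,2)]]) (use p e0 in auto)
    then have 2: "good_shift (m + 1 + (int i + 1)) = (3 * (int i + 1) + 1) * d"
      using IH dm by (simp add: algebra_simps)
    have "good_shift (m - (int i + 1)) + good_shift (m + 1 + 0) + good_shift (m + 1 + (int i + 1)) = 0"
      by (rule good_shift_sum[OF adm1(1)[OF i(3,4)] adm1(2)[of 0] adm1(2)[OF i(3,4)] _ ul[OF i(3,4)]]) (use p e0 in auto)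
    then have "good_shift (m - (int i + 1)) = - ((3 * (int i + 1) + 2) * d)"
      using 2 unfolding d_def by (simp add: algebra_simps)
    then show ?case using 2 by (simp add: algebra_simps)
  qed
  have "good_shift t = - ((3 * e + 2) * d)" using P[of "nat e"] e e0 by simp
  then have dt: "\<bar>good_shift t\<bar> = (3 * e + 2) * \<bar>d\<bar>" using e0 by (simp add: abs_mult)
  have tm: "admissible m" "admissible (m + 1)" "admissible t" using adm1[of 0] adm1(1)[of e] e e0 by auto
  have UL0: "s + (t - t) + e < int (card U) + card L" using ul[of e] e e0 by simp
  obtain a1 a2 a3 where g: "good m a1" "good (m + 1) a2" "good t a3"
    using good_exists[OF tm(1) order_refl UL0] good_exists[OF tm(2) order_refl UL0]
      good_exists[OF tm(3) order_refl UL0] by blast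
  have d0: "1 \<le> \<bar>d\<bar>" using good_facts(1)[OF tm(2) g(2)] unfolding d_def by simp
  have "e \<le> e * \<bar>d\<bar>" using d0 e0 mult_left_mono[of 1 "\<bar>d\<bar>" e] by simp
  then have "2 * \<bar>d\<bar> + 2 * e \<le> \<bar>good_shift t\<bar>" unfolding dt distrib_right using e0 by linarith
  then show ?thesis
    by (intro excess_bound[OF tm(2) g(2) tm(1) g(1) tm(3) g(3)]) (use dm d_def in auto)
qed

text \<open>The basic cycle is now \<open>m\<close>, \<open>m\<close>, \<open>m + 1\<close>, so
  \<open>m\<close> and \<open>m + 1\<close> exchange roles. The factor at \<open>t\<close> is only
  \<open>3 * e + 1\<close>, which suffices once \<open>1 \<le> e\<close>.\<close>

lemma excess_bound_mod1:
  assumes p: "p = 3 * m + 1" and e: "e = m - t" "1 \<le> e" and UL: "2 * m + 1 - t \<le> int (card U) + card L"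
  shows "3 * (int (card U) + card G + card E + card L + card H - s) \<le> 2 * p"
proof -
  define d where "d = good_shift m"
  have adm1: "admissible (m - i)" if "0 \<le> i" "i \<le> e" for i
    using that p e st s1 e0 unfolding admissible_def by auto
  \<comment> \<open>Above \<open>m\<close> admissibility ends one step earlier than for
    \<open>p = 3 * m + 2\<close>, as \<open>p\<close> is smaller by one.\<close>
  have adm2: "admissible (m + 1 + i)" if "0 \<le> i" "i \<le> e - 1" for i
    using that p e st s1 e0 unfolding admissible_def by auto
  have ul: "s + (m - i - t) + e < int (card U) + card L" if "0 \<le> i" "i \<le> e" for i
    using that p e st s1 e0 UL by auto
  have dm: "good_shift (m + 1) = - (2 * d)"
    using good_shift_sum[OF adm1[of 0] adm1[of 0] adm2[of 0] _ ul[of 0]] p e unfolding d_def by simp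
  have step: "good_shift (m - (int i + 1)) = (3 * (int i + 1) + 1) * d"
    if "int i + 1 \<le> e" "good_shift (m + 1 + int i) = - ((3 * int i + 2) * d)" for i
  proof -
    have "good_shift (m - (int i + 1)) + good_shift (m + 1 + 0) + good_shift (m + 1 + int i) = 0"
      by (rule good_shift_sum[OF adm1 adm2 adm2 _ ul]) (use p e that in auto)
    then show ?thesis using that(2) dm by (simp add: algebra_simps)
  qed
  have P: "int i \<le> e - 1 \<Longrightarrow> good_shift (m + 1 + int i) = - ((3 * int i + 2) * d)" for i
  proof (induction i)
    case 0 then show ?case using dm by simp
  next
    case (Suc i)
    then have 1: "good_shift (m - (int i + 1)) = (3 * (int i + 1) + 1) * d" by (intro step) auto
    have "good_shift (m - (int i + 1)) + good_shift (m - 0) + good_shift (m + 1 + (int i + 1)) = 0"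
      by (rule good_shift_sum[OF adm1 adm1 adm2 _ ul]) (use p e Suc in auto)
    then show ?case using 1 unfolding d_def by (simp add: algebra_simps)
  qed
  have "good_shift t = (3 * e + 1) * d"
    using step[of "nat (e - 1)"] P[of "nat (e - 1)"] e by simp
  then have dt: "\<bar>good_shift t\<bar> = (3 * e + 1) * \<bar>d\<bar>" using e0 by (simp add: abs_mult)
  have tm: "admissible m" "admissible (m + 1)" "admissible t" using adm1[of 0] adm2[of 0] adm1[of e] e e0 by auto
  have UL0: "s + (t - t) + e < int (card U) + card L" using ul[of e] e e0 by simp
  obtain a1 a2 a3 where g: "good m a1" "good (m + 1) a2" "good t a3"
    using good_exists[OF tm(1) order_refl UL0] good_exists[OF tm(2) order_refl UL0]
      good_exists[OF tm(3) order_refl UL0] by blast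
  have d0: "1 \<le> \<bar>d\<bar>" using good_facts(1)[OF tm(1) g(1)] unfolding d_def by simp
  have "(3 * e - 1) * 1 \<le> (3 * e - 1) * \<bar>d\<bar>" using d0 e by (intro mult_left_mono) auto
  then have "2 * \<bar>d\<bar> + 2 * e \<le> \<bar>good_shift t\<bar>" unfolding dt distrib_right left_diff_distrib using e by linarith
  then show ?thesis
    by (intro excess_bound[OF tm(1) g(1) tm(2) g(2) tm(3) g(3)]) (use dm d_def in auto)
qed

text \<open>
  Here the generic estimate is short by one. The additional gain comes from the two ends of the window: a point of
  the first or last \<open>w\<close> integers is covered by one translate only, and both are in \<open>X\<close> for few pairs.
\<close>
lemma excess_bound_mod1_tight:
  assumes p: "p = 3 * m + 1" and e: "e = 0" "t = m" and sm: "s < m"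
  shows "3 * (int (card U) + card G + card E + card L + card H - s) \<le> 2 * p"
proof (rule ccontr)
  assume "\<not> ?thesis"
  then have tot: "2 * m + 1 \<le> int (card U) + card G + card E + card L + card H - s" using p by simp
  have UL: "s + (m - t) + e < int (card U) + card L" using tot card_arc e sm by simp
  have adm: "admissible m" "admissible (m + 1)" using p e sm unfolding admissible_def by auto
  obtain a1 a2 where g: "good m a1" "good (m + 1) a2"
    using good_exists[OF adm(1) _ UL] good_exists[OF adm(2) _ UL] e by auto
  define d w where "d = good_shift m" and "w = \<bar>d\<bar>"
  have d1: "good_shift (m + 1) = - (2 * d)" using good_shift_sum[OF adm(1,1,2) _ UL] p unfolding d_def by simp
  have w: "0 < w" "w < p" using good_facts(1,2)[OF adm(1) g(1)] unfolding w_def d_def by auto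
  define M where "M = {j \<in> {1..w}. n - p + j \<in> K ` X \<and> n - w + j \<in> K ` X}"
  define J where "J = {1..w} - M"
  \<comment> \<open>Only the image of \<open>X\<close> itself can cover \<open>n - p + j\<close>,
    and only its translate by \<open>2 * w\<close> can cover \<open>n + w + j\<close>. For
    \<open>j\<close> outside \<open>M\<close> at least one of them is missed.\<close>
  define z where "z j = (if n - p + j \<in> K ` X then n + w + j else n - p + j)" for j
  have Kr: "n - p < K a \<and> K a \<le> n" if "a \<in> X" for a using K[of a] X_in_box[OF that] by auto
  have cover: "3 * int (card X) + card (z ` J) \<le> p + 2 * w"
  proof (rule X_bound[where x = m and y = "m + 1" and D = "good_shift m" and D' = "good_shift (m + 1)"])
    show "z ` J \<subseteq> {n - p + 1..n + 2 * w}" using w unfolding J_def z_def by auto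
    fix k assume "k \<in> z ` J"
    then obtain j where j: "1 \<le> j" "j \<le> w" "j \<notin> M" "k = z j" unfolding J_def by auto
    have out: "k' \<notin> K ` X" if "k' \<le> n - p \<or> n < k'" for k' using Kr that by force
    show "k \<notin> K ` X \<and> k - w \<notin> K ` X \<and> k - 2 * w \<notin> K ` X"
    proof (cases "n - p + j \<in> K ` X")
      case True
      then have "n - w + j \<notin> K ` X" using j unfolding M_def by auto
      moreover have "k = n + w + j" using j True unfolding z_def by simp
      then have "k - 2 * w = n - w + j" "n < k" "n < k - w" using j w by auto
      ultimately show ?thesis using out[of k] out[of "k - w"] by (simp only:) blast
    next
      case False
      then have "k = n - p + j" using j unfolding z_def by simp
      then show ?thesis using out j w False by auto
    qed
  qed (use good_facts[OF adm(1) g(1)] good_facts[OF adm(2) g(2)] admissible_bounds[OF adm(1)]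
      admissible_bounds[OF adm(2)] w d1 in \<open>auto simp: w_def d_def\<close>)
  have inj: "inj_on K X" using K_inj X_in_box unfolding inj_on_def by blast
  have "inj_on z J" unfolding inj_on_def z_def J_def using w p2 by auto
  then have "card (z ` J) = card J" by (rule card_image)
  moreover have M: "M \<subseteq> {1..w}" unfolding M_def by auto
  moreover have "card J = card {1..w} - card M"
    unfolding J_def using M by (intro card_Diff_subset) (auto intro: finite_subset)
  moreover have "card M \<le> card {1..w}" using M by (intro card_mono) auto
  ultimately have cJ: "int (card (z ` J)) = w - card M" using w by simp
  \<comment> \<open>For \<open>j\<close> in \<open>M\<close> the two values are \<open>p - w\<close>
    apart. In one direction this is \<open>d\<close> modulo \<open>p\<close>, so the digits differ
    by the shift \<open>m\<close>, and \<open>M\<close> injects into \<open>R\<close>.\<close>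
  define R where "R = {a \<in> X. (a + m) mod p \<in> X}"
  have MR: "card M \<le> card R"
  proof -
    \<comment> \<open>The value from which the shift \<open>m\<close> starts; the sign of
      \<open>d\<close> decides which of the two it is.\<close>
    define h where "h j = (if d < 0 then n - p + j else n - w + j)" for j
    have "h ` M \<subseteq> K ` R"
    proof
      fix k assume "k \<in> h ` M"
      then obtain j where j: "j \<in> M" "k = h j" by auto
      obtain a a' where a: "a \<in> X" "a' \<in> X" "n - p + j = K a" "n - w + j = K a'"
        using j unfolding M_def by auto
      have r: "0 \<le> a" "a < p" "0 \<le> a'" "a' < p" using X_in_box a by auto
      have dv: "p dvd d - m * (q * r)" unfolding d_def by (rule good_facts(4)[OF adm(1) g(1)])
      show "k \<in> K ` R"
      proof (cases "d < 0")
        case True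
        have "K a' - K a = d + p" using a(3,4) True unfolding w_def by linarith
        then have "K a' - K a - m * (q * r) = (d - m * (q * r)) + p" by simp
        then have "p dvd K a' - K a - m * (q * r)" using dvd_add[OF dv dvd_refl] by (simp only:)
        then have "a' = (a + m) mod p" by (intro shift_of_K_diff[OF r])
        then show ?thesis using a j True unfolding R_def h_def by auto
      next
        case False
        have "K a - K a' = d - p" using a(3,4) False unfolding w_def by linarith
        then have "K a - K a' - m * (q * r) = (d - m * (q * r)) - p" by simp
        then have "p dvd K a - K a' - m * (q * r)" using dvd_diff[OF dv dvd_refl] by (simp only:)
        then have "a = (a' + m) mod p" by (intro shift_of_K_diff[OF r(3,4,1,2)])
        then show ?thesis using a j False unfolding R_def h_def by auto
      qed
    qed
    then have "card (h ` M) \<le> card (K ` R)" unfolding R_def by (intro card_mono) auto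
    also have "\<dots> \<le> card R" by (rule card_image_le) (simp add: R_def)
    also have "card (h ` M) = card M" by (rule card_image) (auto simp: inj_on_def h_def)
    finally show ?thesis .
  qed
  \<comment> \<open>A digit of \<open>E\<close> above \<open>2 * m\<close> wraps around to one below
    \<open>m\<close>, where \<open>X\<close> has only members of \<open>G\<close>.\<close>
  have "R \<subseteq> {s + m..2 * m} \<union> G \<union> H \<union> (\<lambda>a. a - m + p) ` G"
  proof
    fix a assume "a \<in> R"
    then have a: "a \<in> X" "(a + m) mod p \<in> X" unfolding R_def by auto
    show "a \<in> {s + m..2 * m} \<union> G \<union> H \<union> (\<lambda>a. a - m + p) ` G"
    proof (cases "a \<in> G \<union> H")
      case False
      then have aE: "a \<in> E" using a unfolding X_def by auto
      note ra = in_range(5)[OF aE]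
      show ?thesis
      proof (cases "a \<le> 2 * m")
        case True then show ?thesis using ra e by auto
      next
        case False
        have "(a + m) mod p = a + m - p"
          using mod_pos_pos_trivial[of "a + m - p" p] minus_mod_self2[of "a + m" p] False ra p by simp
        then have "a + m - p \<in> X" using a by simp
        moreover have "a + m - p < m" using ra by simp
        ultimately have "a + m - p \<in> G" using in_range(4,5) e s1 unfolding X_def by fastforce
        then have "a \<in> (\<lambda>a. a - m + p) ` G" by force
        then show ?thesis by blast
      qed
    qed auto
  qed
  then have "card R \<le> card ({s + m..2 * m} \<union> G \<union> H \<union> (\<lambda>a. a - m + p) ` G)"
    by (intro card_mono) auto
  also have "\<dots> \<le> card {s + m..2 * m} + card G + card H + card ((\<lambda>a. a - m + p) ` G)"
    by (meson card_Un_le add_le_mono le_trans order_refl)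
  also have "card ((\<lambda>a. a - m + p) ` G) = card G" by (rule card_image) (simp add: inj_on_def)
  finally have cR: "int (card R) \<le> (m - s + 1) + 2 * card G + card H" using sm by simp
  \<comment> \<open>The shift \<open>m + 1\<close> has the larger difference \<open>2 * w\<close>,
    at the cost of one because it exceeds \<open>t\<close> by one.\<close>
  have "2 * int (card U) + 2 * card L \<le> p - 2 * w + s + 1"
    using good_shift_bound[OF adm(2) g(2)] d1 e unfolding w_def by simp
  then show False using cover cJ MR cR card_X card_E_ge tot card_regions p e sm by linarith
qed

text \<open>
  Now \<open>s = t = (p - 1) / 3\<close> forces \<open>q * r\<close> to be \<open>9\<close> or \<open>-9\<close> modulo \<open>p\<close>, and hence \<open>w = 3\<close>.
  Nowhere else does the value of \<open>q * r\<close> modulo \<open>p\<close> matter.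
\<close>
lemma excess_bound_mod1_equal:
  assumes p: "p = 3 * m + 1" "6 \<le> p" and e: "e = 0" "t = m" and sm: "s = m"
  shows "3 * (int (card U) + card G + card E + card L + card H - s) \<le> 2 * p"
proof (rule ccontr)
  assume "\<not> ?thesis"
  then have tot: "2 * m + 1 \<le> int (card U) + card G + card E + card L + card H - s" using p by simp
  have UL: "s + (m - t) + e < int (card U) + card L" using tot card_arc e sm by simp
  have adm: "admissible m" using p e sm unfolding admissible_def by auto
  define d where "d = good_shift m"
  have Efull: "a \<in> E" if "2 * m \<le> a" "a < p" for a
  proof (rule ccontr)
    assume "a \<notin> E"
    then have "int (card {a}) \<le> e" using that e sm by (intro card_lost) auto
    then show False using e by simp
  qed
  obtain a where a: "a \<in> U" "a + m \<in> L" "a + m + m \<in> E"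
    using ULE_chain[OF _ _ _ UL, of m] e sm p by auto
  have ra: "0 \<le> a" "a < m" using in_range(1)[OF a(1)] sm by auto
  have aE: "a - m + p \<in> E" using ra p by (intro Efull) auto
  have g: "good m a" "good m (a - m + p)" using a aE unfolding good_def by auto
  have "a mod p = a" using ra p by simp
  then have m1: "(a + m) mod p = a + m" "(a - m + p + m) mod p = a"
    using ra p mod_add_self2[of a p] by (auto simp: algebra_simps)
  have dd1: "K (a + m) - K a = d" "K a - K (a - m + p) = d"
    using good_shift_eq[OF adm g(1)] good_shift_eq[OF adm g(2)] unfolding m1 d_def by auto
  \<comment> \<open>Two consecutive good steps through \<open>a\<close> have total difference
    \<open>2 * d\<close> inside one window.\<close>
  have "\<bar>K (a + m) - K (a - m + p)\<bar> < p" using ra p by (intro K_diff_lt) auto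
  then have d2: "\<bar>2 * d\<bar> < p" using dd1 by linarith
  have dv: "p dvd d - m * (q * r)" unfolding d_def by (rule good_facts(4)[OF adm g(1)])
  \<comment> \<open>Modulo \<open>p\<close>, \<open>3 * m\<close> is \<open>-1\<close> and
    \<open>m * m * q * r\<close> is \<open>u * v\<close>, so \<open>d\<close> is
    \<open>- 3 * u * v\<close>. With \<open>2 * \<bar>d\<bar> < p\<close> and
    \<open>6 \<le> p\<close> the congruence becomes an equality.\<close>
  have d3: "\<bar>d\<bar> = 3"
  proof -
    define u v where "u = m * r - p * r + C * p" and "v = m * q - p * q + B * p"
    have uv: "\<bar>u\<bar> = 1" "\<bar>v\<bar> = 1"
      using sC tB e sm unfolding u_def v_def by (simp_all add: algebra_simps)
    have "p dvd (m * q) * (m * r) - u * v"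
    proof -
      have "(m * q) * (m * r) - u * v = p * (m * q * (r - C) + u * (q - B))"
        unfolding u_def v_def by (simp add: algebra_simps)
      then show ?thesis by simp
    qed
    moreover have "p dvd m * (3 * (u * v)) + u * v"
    proof -
      have "m * (3 * (u * v)) + u * v = p * (u * v)" using p by (simp add: algebra_simps)
      then show ?thesis by simp
    qed
    moreover have "p dvd m * (d - m * (q * r))" using dv by simp
    ultimately have "p dvd m * (d - m * (q * r)) + (((m * q) * (m * r) - u * v) + (m * (3 * (u * v)) + u * v))"
      by (meson dvd_add)
    then have "p dvd m * (d + 3 * (u * v))" by (simp add: algebra_simps)
    moreover have "coprime p m"
    proof (rule coprimeI)
      fix k assume "k dvd p" "k dvd m"
      then have "k dvd p - 3 * m" by (intro dvd_diff) auto
      then show "is_unit k" using p by simp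
    qed
    ultimately have "p dvd d + 3 * (u * v)" by (simp add: coprime_dvd_mult_right_iff)
    moreover have "\<bar>u * v\<bar> = 1" using uv by (simp add: abs_mult)
    then have "\<bar>d + 3 * (u * v)\<bar> < p" using d2 p by linarith
    ultimately have "d + 3 * (u * v) = 0" using dvd_imp_le_int[of "d + 3 * (u * v)" p] pos by linarith
    then show ?thesis using \<open>\<bar>u * v\<bar> = 1\<close> by linarith
  qed
  have g2: "good (m + 1) (a + m + m)" using a p unfolding good_def by auto
  have m2: "(a + m + m + (m + 1)) mod p = a"
  proof -
    have eq: "a + m + m + (m + 1) = a + p" using p by simp
    show ?thesis using \<open>a mod p = a\<close> unfolding eq mod_add_self2 .
  qed
  have d6: "K a - K (a + m + m) = - (2 * d)"
  proof -
    have "good m (a + m)" using a unfolding good_def by auto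
    then have "K (a + m + m) - K (a + m) = d" using good_shift_eq[OF adm, of "a + m"] in_range(5)[OF a(3)] d_def by simp
    then show ?thesis using dd1 by simp
  qed
  have "3 * int (card X) + card ({} :: int set) \<le> p + 2 * 3"
  proof (rule X_bound[where x = m and y = "m + 1" and D = d and D' = "- (2 * d)"])
    show "\<not> box_shift (m + 1) (- (2 * d))" using good_not_box_shift[OF g2] d6 e unfolding m2 by simp
    show "p dvd - (2 * d) - (m + 1) * (q * r)"
      using K_sh_mod[of "a + m + m" "m + 1"] in_range(5)[OF a(3)] d6 unfolding m2 by simp
    show "\<not> box_shift m d" unfolding d_def by (rule good_facts(3)[OF adm g(1)])
  qed (use p e sm d3 dv in auto)
  then have c1: "int (card G) + card H \<le> 1" using card_X card_E_ge p e sm by simp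
  have "2 * int (card U) + 2 * card L \<le> p - 3 + m"
    using good_shift_bound[OF adm g(1)] d3 e sm unfolding d_def by simp
  then have c2: "1 \<le> int (card G) + card H" using tot card_regions p e sm by linarith
  define A where "A = {a \<in> {0..<p}. K ((a + m) mod p) - K a = d}"
  have cA: "int (card A) \<le> p - 3" unfolding A_def using card_diff_le[of d m] d2 d3 by simp
  have sub: "{a. good m a} \<subseteq> A" unfolding A_def d_def by (rule good_sub) (use good_shift_eq[OF adm] in auto)
  have "p - 3 \<le> int (card {a. good m a})"
    using card_good[of m] tot card_regions c1 p e sm by simp
  moreover have "finite A" unfolding A_def by (rule finite_subset[of _ "{0..<p}"]) auto
  \<comment> \<open>The lower count of good digits meets the upper count of occurrences of
    \<open>d\<close>, so \<open>d\<close> occurs at good digits only.\<close>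
  ultimately have Aeq: "{a. good m a} = A"
    using cA sub by (intro card_seteq) auto
  have bad: "K ((a + m) mod p) - K a = (if 0 < d then d - p else d + p)"
    if "0 \<le> a" "a < p" "\<not> good m a" for a
  proof -
    have ne: "K ((a + m) mod p) - K a \<noteq> d" using that Aeq unfolding A_def by auto
    have "p dvd (K ((a + m) mod p) - K a - m * (q * r)) - (d - m * (q * r))"
      by (rule dvd_diff[OF K_sh_mod[OF that(1,2)] dv])
    then obtain k where k: "K ((a + m) mod p) - K a = d + p * k" by (auto simp: dvd_def algebra_simps)
    have lt: "\<bar>d + p * k\<bar> < p" using K_diff_lt[OF that(1,2) sh_range[of a m]] k by simp
    have "k < 2"
    proof (rule ccontr)
      assume "\<not> k < 2"
      then have "p * 2 \<le> p * k" using pos by (intro mult_left_mono) auto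
      then show False using lt d2 by linarith
    qed
    moreover have "- 2 < k"
    proof (rule ccontr)
      assume "\<not> - 2 < k"
      then have "p * k \<le> p * (- 2)" using pos by (intro mult_left_mono) auto
      then show False using lt d2 by linarith
    qed
    moreover have "k \<noteq> 0" using ne k by auto
    ultimately have "k = 1 \<or> k = -1" by linarith
    then show ?thesis using k lt by auto
  qed
  obtain h where h: "h \<in> G \<union> H"
  proof -
    have "G \<union> H \<noteq> {}" using c2 by auto
    then show ?thesis using that by blast
  qed
  have "0 \<le> h \<and> h < 2 * m \<and> h \<notin> U \<and> h \<notin> L"
  proof (cases "h \<in> G")
    case True
    have "S h = 1" using True by (simp add: G_def)
    then have "h \<notin> U" by (simp add: U_def)
    moreover have "h \<notin> L" using in_range(2)[OF True] in_range(3)[of h] st by linarith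
    ultimately show ?thesis using in_range(2)[OF True] sm s1 by linarith
  next
    case False
    then have hH: "h \<in> H" using h by simp
    have "S h = 2" using hH by (simp add: H_def)
    then have "h \<notin> L" by (simp add: L_def)
    moreover have "h \<notin> U" using in_range(4)[OF hH] in_range(1)[of h] st by linarith
    ultimately show ?thesis using in_range(4)[OF hH] sm e s1 by linarith
  qed
  then have rh: "0 \<le> h" "h < 2 * m" and hn: "h \<notin> U" "h \<notin> L" by auto
  have hE: "h \<notin> E" using rh in_range(5)[of h] e sm by linarith
  have nh: "\<not> good m h" using hn hE unfolding good_def by auto
  \<comment> \<open>\<open>h'\<close> precedes \<open>h\<close> under the shift \<open>m\<close>,
    and neither is good. Both steps then have the same difference, of size \<open>p - 3\<close>; two
    of them do not fit into the window as \<open>6 \<le> p\<close>.\<close>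
  define h' where "h' = (if h < m then h - m + p else h - m)"
  have h': "0 \<le> h'" "h' < p" using rh p unfolding h'_def by auto
  have "h mod p = h" using rh p by simp
  then have mh: "(h' + m) mod p = h" using mod_add_self2[of h p] unfolding h'_def by (auto simp: algebra_simps)
  have mh2: "(h + m) mod p = h + m" using rh p by auto
  have nh': "\<not> good m h'"
    using good_shift_eq[OF adm, of h'] hn hE good_sh[of h' m] mh unfolding good_def by metis
  have "\<bar>K (h + m) - K h'\<bar> < p" using rh h' p by (intro K_diff_lt) auto
  then show False using bad[OF h' nh'] bad[OF rh(1) _ nh] rh p d3 unfolding mh mh2 by (auto split: if_splits)
qed

end

section \<open>The bound for the sum over a window\<close>

context ternary_window
begin

theorem sum_T_bound:
  assumes "prime p" shows "3 * (\<Sum>a\<in>{0..<p}. T a) \<le> 2 * p"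
proof (rule ccontr)
  assume contr: "\<not> ?thesis"
  define tau where "tau = (\<Sum>a\<in>{0..<p}. T a)"
  have tau: "2 * p + 1 \<le> 3 * tau" using contr unfolding tau_def by simp
  have t3: "3 * t < p" using sum_T_le' tau unfolding tau_def by linarith
  \<comment> \<open>\<open>m - t\<close> is the number of digits of \<open>{s + t..<p}\<close> that
    may be missing from \<open>E\<close> when the sum exceeds \<open>2 * p / 3\<close>.\<close>
  define m e where "m = p div 3" and "e = m - t"
  have div: "k = 1 \<or> k = p" if "0 \<le> k" "k dvd p" for k
    using assms that unfolding prime_int_iff by blast
  have "\<not> 3 dvd p"
  proof
    assume "3 dvd p"
    then have "3 = p" using div[of 3] by simp
    then show False using t3 s1 st by simp
  qed
  then have pm: "p = 3 * m + 1 \<or> p = 3 * m + 2" unfolding m_def by presburger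
  \<comment> \<open>In the case \<open>s = m\<close> below, 4 is the only value of \<open>p\<close>
    under 6 left to exclude.\<close>
  have p4: "p \<noteq> 4" using div[of 2] by auto
  have le: "tau \<le> int (card U) + card G + card E + card L + card H - s"
    unfolding tau_def by (rule sum_T_le)
  note UG = card_regions(1) and LH = card_regions(2)
  have UL: "tau - t \<le> int (card U) + card L" using le card_arc by linarith
  have tm: "2 * m + 1 \<le> tau" "t \<le> m" using tau t3 pm by auto
  have goal: "\<not> 3 * (int (card U) + card G + card E + card L + card H - s) \<le> 2 * p"
  proof
    assume "3 * (int (card U) + card G + card E + card L + card H - s) \<le> 2 * p"
    with mult_left_mono[OF le, of 3] tau show False by simp
  qed
  interpret ternary_excess p q r s t B C n K b c S e
  proof unfold_locales
    show "0 \<le> e" using tm unfolding e_def by simp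
    show "p - s - t - int (card E) \<le> e" using le UG LH tau pm unfolding e_def by linarith
    show "e < t" using le UG LH tm card_arc st unfolding e_def by linarith
    show "s + 2 * t + e < p" using st tm pm unfolding e_def by linarith
  qed
  show False
  proof (cases "p = 3 * m + 2")
    case True
    then show False using excess_bound_mod2[OF True e_def] goal UL tau by linarith
  next
    case False
    then have p: "p = 3 * m + 1" using pm by simp
    consider "1 \<le> e" | "e = 0" "s < m" | "e = 0" "s = m" using tm st unfolding e_def by linarith
    then show False
    proof cases
      case 1
      then show False using excess_bound_mod1[OF p e_def] goal UL tm by linarith
    next
      case 2
      then show False using excess_bound_mod1_tight[OF p 2(1) _ 2(2)] goal unfolding e_def by simp
    next
      case 3
      moreover have "6 \<le> p" using p p4 s1 3 by presburger
      ultimately show False using excess_bound_mod1_equal[OF p _ 3(1) _ 3(2)] goal unfolding e_def by simp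
    qed
  qed
qed

end

section \<open>Second differences of representable numbers\<close>

definition ternary_rep :: "int \<Rightarrow> int \<Rightarrow> int \<Rightarrow> int \<Rightarrow> int \<Rightarrow> int \<Rightarrow> int \<Rightarrow> int \<Rightarrow> bool" where
  "ternary_rep p q r k a b c S \<longleftrightarrow> 0 \<le> a \<and> a < p \<and> 0 \<le> b \<and> b < q \<and> 0 \<le> c \<and> c < r \<and>
     a * (q * r) + b * (p * r) + c * (p * q) = k + S * (p * q * r)"

definition representable :: "int \<Rightarrow> int \<Rightarrow> int \<Rightarrow> int \<Rightarrow> bool" where
  "representable p q r k \<longleftrightarrow> (\<exists>a b c. ternary_rep p q r k a b c 0)"

definition second_diff :: "int \<Rightarrow> int \<Rightarrow> int \<Rightarrow> int \<Rightarrow> int \<Rightarrow> int \<Rightarrow> int" where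
  "second_diff p q r u v k = of_bool (representable p q r k) - of_bool (representable p q r (k - u))
     - of_bool (representable p q r (k - v)) + of_bool (representable p q r (k - u - v))"

lemma ternary_rep_swap: "ternary_rep p q r k a b c S \<longleftrightarrow> ternary_rep p r q k a c b S"
  unfolding ternary_rep_def by (auto simp: algebra_simps)

lemma representable_swap: "representable p q r k \<longleftrightarrow> representable p r q k"
  unfolding representable_def by (metis ternary_rep_swap)

lemma second_diff_swap: "second_diff p q r u v k = second_diff p r q v u k"
  unfolding second_diff_def by (simp add: representable_swap[of p q r] diff_diff_eq add.commute)

section \<open>Digits and carries by the Chinese remainder theorem\<close>

lemma coprime_solve:
  fixes m u k :: int assumes "0 < m" "coprime m u"
  shows "\<exists>x. 0 \<le> x \<and> x < m \<and> m dvd x * u - k"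
proof -
  obtain y where "[u * y = 1] (mod m)" using cong_solve_coprime_int[of u m] assms by (auto simp: coprime_commute)
  then have "[k * (u * y) = k * 1] (mod m)" by (intro cong_mult cong_refl)
  then have "m dvd (k * y) * u - k" by (simp add: cong_iff_dvd_diff algebra_simps)
  then have "m dvd ((k * y) * u - k) - m * (((k * y) div m) * u)" by (rule dvd_diff) auto
  also have "((k * y) * u - k) - m * (((k * y) div m) * u) = ((k * y) - m * ((k * y) div m)) * u - k"
    by (simp add: algebra_simps)
  also have "(k * y) - m * ((k * y) div m) = (k * y) mod m" by (simp add: minus_mult_div_eq_mod)
  finally show ?thesis using assms(1) by (intro exI[of _ "(k * y) mod m"]) auto
qed

text \<open>Modulo each of \<open>p\<close>, \<open>q\<close>, \<open>r\<close> a single term with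
  an invertible factor survives and fixes its digit.\<close>

lemma ternary_rep_unique:
  assumes cop: "coprime p q" "coprime p r" "coprime q r" and pos: "0 < p" "0 < q" "0 < (r::int)"
    and 1: "ternary_rep p q r k a b c S" and 2: "ternary_rep p q r k a' b' c' S'"
  shows "a = a' \<and> b = b' \<and> c = c' \<and> S = S'"
proof -
  have eq: "(a - a') * (q * r) + (b - b') * (p * r) + (c - c') * (p * q) = (S - S') * (p * q * r)"
    using 1 2 unfolding ternary_rep_def by (simp add: algebra_simps)
  have small: "x = y" if "m dvd x - y" "0 \<le> x" "x < m" "0 \<le> y" "y < m" for m x y :: int
    using that by (metis mod_eq_dvd_iff mod_pos_pos_trivial)
  have "(a - a') * (q * r) = p * ((S - S') * (q * r) - (b - b') * r - (c - c') * q)"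
    using eq by (simp add: algebra_simps)
  then have "p dvd (a - a') * (q * r)" by (metis dvd_triv_left)
  moreover have "coprime p (q * r)" using cop by simp
  ultimately have "p dvd a - a'" by (simp add: coprime_dvd_mult_left_iff)
  then have a: "a = a'" using small 1 2 unfolding ternary_rep_def by blast
  have "(b - b') * (p * r) = q * ((S - S') * (p * r) - (a - a') * r - (c - c') * p)"
    using eq by (simp add: algebra_simps)
  then have "q dvd (b - b') * (p * r)" by (metis dvd_triv_left)
  moreover have "coprime q (p * r)" using cop by (simp add: coprime_commute)
  ultimately have "q dvd b - b'" by (simp add: coprime_dvd_mult_left_iff)
  then have b: "b = b'" using small 1 2 unfolding ternary_rep_def by blast
  have "(c - c') * (p * q) = r * ((S - S') * (p * q) - (a - a') * q - (b - b') * p)"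
    using eq by (simp add: algebra_simps)
  then have "r dvd (c - c') * (p * q)" by (metis dvd_triv_left)
  moreover have "coprime r (p * q)" using cop by (simp add: coprime_commute)
  ultimately have "r dvd c - c'" by (simp add: coprime_dvd_mult_left_iff)
  then have c: "c = c'" using small 1 2 unfolding ternary_rep_def by blast
  have "S = S'" using eq a b c pos by simp
  then show ?thesis using a b c by simp
qed

lemma ternary_rep_exists:
  assumes cop: "coprime p q" "coprime p r" "coprime q r" and pos: "0 < p" "0 < q" "0 < (r::int)"
  shows "\<exists>a b c S. ternary_rep p q r k a b c S"
proof -
  obtain a where a: "0 \<le> a" "a < p" "p dvd a * (q * r) - k" using coprime_solve[of p "q * r"] cop pos by auto
  obtain b where b: "0 \<le> b" "b < q" "q dvd b * (p * r) - k"
    using coprime_solve[of q "p * r"] cop pos by (auto simp: coprime_commute)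
  obtain c where c: "0 \<le> c" "c < r" "r dvd c * (p * q) - k"
    using coprime_solve[of r "p * q"] cop pos by (auto simp: coprime_commute)
  let ?D = "a * (q * r) + b * (p * r) + c * (p * q) - k"
  have "p dvd (a * (q * r) - k) + p * (b * r + c * q)" by (rule dvd_add[OF a(3)]) simp
  then have "p dvd ?D" by (simp add: algebra_simps)
  moreover have "q dvd (b * (p * r) - k) + q * (a * r + c * p)" by (rule dvd_add[OF b(3)]) simp
  then have "q dvd ?D" by (simp add: algebra_simps)
  ultimately have "p * q dvd ?D" using cop by (simp add: divides_mult)
  moreover have "r dvd (c * (p * q) - k) + r * (a * q + b * p)" by (rule dvd_add[OF c(3)]) simp
  then have "r dvd ?D" by (simp add: algebra_simps)
  moreover have "coprime (p * q) r" using cop by simp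
  ultimately have "p * q * r dvd ?D" by (rule divides_mult)
  then obtain S where "?D = p * q * r * S" by (auto simp: dvd_def)
  then show ?thesis using a b c unfolding ternary_rep_def
    by (intro exI[of _ a] exI[of _ b] exI[of _ c] exI[of _ S]) (auto simp: algebra_simps)
qed

lemma representable_iff:
  assumes cop: "coprime p q" "coprime p r" "coprime q r" and pos: "0 < p" "0 < q" "0 < (r::int)"
    and rep: "ternary_rep p q r k a b c S"
  shows "representable p q r k \<longleftrightarrow> S = 0"
  using ternary_rep_unique[OF cop pos rep] rep unfolding representable_def by blast

text \<open>By \<open>eq\<close>, \<open>d * q\<close> is \<open>s\<close> units of the first digit
  and \<open>C\<close> of the third, less \<open>p * q * r\<close>; each borrow adds one
  \<open>p * q * r\<close> back.\<close>

lemma ternary_rep_shift: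
  assumes rep: "ternary_rep p q r k a b c S" and s: "0 \<le> s" "s \<le> p" "0 \<le> C" "C \<le> r"
    and eq: "s * r + C * p = p * r + d"
  shows "ternary_rep p q r (k - d * q) (if a < s then a - s + p else a - s) b
    (if c < C then c - C + r else c - C) (S + of_bool (a < s) - of_bool (C \<le> c))"
proof -
  have "s * (q * r) + C * (p * q) = q * (s * r + C * p)" by (simp add: algebra_simps)
  then have "s * (q * r) + C * (p * q) = p * q * r + d * q" unfolding eq by (simp add: algebra_simps)
  then show ?thesis using rep s unfolding ternary_rep_def by (auto simp: algebra_simps)
qed

lemma ternary_rep_shift':
  assumes rep: "ternary_rep p q r k a b c S" and s: "0 \<le> t" "t \<le> p" "0 \<le> B" "B \<le> q"
    and eq: "t * q + B * p = p * q + d"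
  shows "ternary_rep p q r (k - d * r) (if a < t then a - t + p else a - t)
    (if b < B then b - B + q else b - B) c (S + of_bool (a < t) - of_bool (B \<le> b))"
proof -
  have "ternary_rep p r q k a c b S" using rep ternary_rep_swap by blast
  from ternary_rep_shift[OF this s eq] show ?thesis using ternary_rep_swap by blast
qed

text \<open>The sign \<open>d\<close> makes \<open>s\<close>, which is \<open>d\<close> times the inverse of \<open>r\<close> modulo \<open>p\<close>, at most \<open>p / 2\<close>.\<close>
lemma inverse_sign:
  fixes p r :: int assumes p: "2 \<le> p" "p < r" "coprime p r"
  shows "\<exists>s C d. \<bar>d\<bar> = 1 \<and> 1 \<le> s \<and> 2 * s \<le> p \<and> 0 \<le> C \<and> C \<le> r \<and> s * r + C * p = p * r + d"
proof -
  obtain s0 where s0: "0 \<le> s0" "s0 < p" "p dvd s0 * r - 1" using coprime_solve[of p r 1] p by auto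
  have "s0 \<noteq> 0"
  proof
    assume "s0 = 0"
    then have "p dvd 1" using s0 by simp
    then show False using p by simp
  qed
  define s d where "s = (if 2 * s0 \<le> p then s0 else p - s0)" and "d = (if 2 * s0 \<le> p then 1 else - 1 :: int)"
  have s: "1 \<le> s" "2 * s \<le> p" "\<bar>d\<bar> = 1" using s0 \<open>s0 \<noteq> 0\<close> unfolding s_def d_def by auto
  have "p dvd s * r - d"
  proof (cases "2 * s0 \<le> p")
    case True then show ?thesis using s0 unfolding s_def d_def by simp
  next
    case False
    have "p dvd p * r - (s0 * r - 1)" by (rule dvd_diff[OF _ s0(3)]) simp
    then show ?thesis using False unfolding s_def d_def by (simp add: algebra_simps)
  qed
  then obtain j where j: "s * r - d = p * j" by (auto simp: dvd_def)
  have sr: "1 * r \<le> s * r" "2 * s * r \<le> p * r" using s p by (auto intro!: mult_right_mono)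
  have p0: "0 < p" using p by simp
  have "p * j < p * r" using j sr s p by linarith
  then have "j < r" using mult_less_cancel_left_pos[OF p0] by blast
  have "p * (- 1) < p * j" using j sr s p by linarith
  then have "- 1 < j" using mult_less_cancel_left_pos[OF p0] by blast
  show ?thesis
    using s j \<open>j < r\<close> \<open>- 1 < j\<close> by (intro exI[of _ s] exI[of _ "r - j"] exI[of _ d]) (auto simp: algebra_simps)
qed

section \<open>From digit windows to sums of second differences\<close>

lemma window_bound:
  fixes p q r n s t B C u v :: int
  assumes prime: "prime p" and pq: "p < q" and pr: "p < r"
    and cop: "coprime p q" "coprime p r" "coprime q r"
    and n: "- q - r \<le> n" "n < p * q * r - q - r"
    and s: "1 \<le> s" "s \<le> t" "2 * t \<le> p"
    and C: "0 \<le> C" "C \<le> r" "s * r + C * p = p * r + u" "\<bar>u\<bar> = 1"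
    and B: "0 \<le> B" "B \<le> q" "t * q + B * p = p * q + v" "\<bar>v\<bar> = 1"
  shows "3 * \<bar>\<Sum>k\<in>{n - p + 1..n}. second_diff p q r (u * q) (v * r) k\<bar> \<le> 2 * p"
proof -
  have p2: "2 \<le> p" using prime by (simp add: prime_ge_2_int)
  have pos: "0 < p" "0 < q" "0 < r" using p2 pq pr by auto
  have "\<forall>k. \<exists>y. ternary_rep p q r k (fst y) (fst (snd y)) (fst (snd (snd y))) (snd (snd (snd y)))"
    using ternary_rep_exists[OF cop pos] by simp
  then obtain f where f: "\<And>k. ternary_rep p q r k (fst (f k)) (fst (snd (f k))) (fst (snd (snd (f k)))) (snd (snd (snd (f k))))"
    by metis
  \<comment> \<open>The integer of the window congruent to \<open>a * q * r\<close> modulo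
    \<open>p\<close>, which makes \<open>a\<close> its first digit.\<close>
  define K where "K a = n - ((n - a * (q * r)) mod p)" for a
  define b c S where "b a = fst (snd (f (K a)))" and "c a = fst (snd (snd (f (K a))))"
    and "S a = snd (snd (snd (f (K a))))" for a
  have rep: "ternary_rep p q r (K a) a (b a) (c a) (S a)" if a: "0 \<le> a" "a < p" for a
  proof -
    define a' where "a' = fst (f (K a))"
    have r: "ternary_rep p q r (K a) a' (b a) (c a) (S a)" unfolding a'_def b_def c_def S_def using f .
    have "K a = a * (q * r) + p * ((n - a * (q * r)) div p)"
      unfolding K_def using minus_mod_eq_mult_div[of "n - a * (q * r)" p] by simp
    then have "(a' - a) * (q * r) = p * ((n - a * (q * r)) div p - b a * r - c a * q + S a * (q * r))"
      using r unfolding ternary_rep_def by (simp add: algebra_simps)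
    then have "p dvd (a' - a) * (q * r)" by (metis dvd_triv_left)
    moreover have "coprime p (q * r)" using cop by simp
    ultimately have "p dvd a' - a" by (simp add: coprime_dvd_mult_left_iff)
    then have "a' = a" using r a unfolding ternary_rep_def by (metis mod_eq_dvd_iff mod_pos_pos_trivial)
    then show ?thesis using r by simp
  qed
  interpret ternary_window p q r s t B C n K b c S
  proof
    fix a assume "0 \<le> a" "a < p"
    from rep[OF this] show "a * (q * r) + b a * (p * r) + c a * (p * q) = K a + S a * (p * q * r)"
      "0 \<le> b a \<and> b a < q" "0 \<le> c a \<and> c a < r" unfolding ternary_rep_def by auto
    show "n - p < K a \<and> K a \<le> n" unfolding K_def using pos_mod_bound[OF pos(1)] pos_mod_sign[OF pos(1)] by auto
  qed (use p2 pq pr cop n s C B in auto)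
  have Tk: "second_diff p q r (u * q) (v * r) (K a) = T a" if a: "0 \<le> a" "a < p" for a
  proof -
    have spt: "0 \<le> s" "s \<le> p" "0 \<le> t" "t \<le> p" using s by auto
    note r0 = rep[OF a]
    note ru = ternary_rep_shift[OF r0 spt(1,2) C(1-3)]
    note rv = ternary_rep_shift'[OF r0 spt(3,4) B(1-3)]
    note ruv = ternary_rep_shift'[OF ru spt(3,4) B(1-3)]
    \<comment> \<open>At most one of the two successive subtractions from \<open>a\<close> borrows,
      since \<open>s + t\<close> is at most \<open>p\<close>.\<close>
    have split: "of_bool (a < s) + of_bool ((if a < s then a - s + p else a - s) < t) = (of_bool (a < s + t) :: int)"
      using a s by auto
    note ri = representable_iff[OF cop(1-3) pos(1-3)]
    show ?thesis
      unfolding second_diff_def T_def ri[OF r0] ri[OF ru] ri[OF rv] ri[OF ruv]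
      using split by (auto simp: algebra_simps)
  qed
  have inj: "inj_on K {0..<p}" using K_inj unfolding inj_on_def by auto
  have img: "K ` {0..<p} = {n - p + 1..n}"
  proof (rule card_subset_eq)
    show "K ` {0..<p} \<subseteq> {n - p + 1..n}" using K by force
    show "card (K ` {0..<p}) = card {n - p + 1..n}" using inj by (simp add: card_image)
  qed simp
  have "(\<Sum>k\<in>{n - p + 1..n}. second_diff p q r (u * q) (v * r) k) = (\<Sum>a\<in>{0..<p}. T a)"
    unfolding img[symmetric] sum.reindex[OF inj] comp_def by (rule sum.cong) (use Tk in auto)
  \<comment> \<open>On the negative side the trivial bound \<open>- t\<close> is enough because
    \<open>2 * t \<le> p\<close>.\<close>
  then show ?thesis using sum_T_bound[OF prime] sum_T_ge s by auto
qed

text \<open>Exchanging \<open>q\<close> and \<open>r\<close> exchanges \<open>s\<close> and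
  \<open>t\<close> and so removes the assumption \<open>s \<le> t\<close>.\<close>

lemma window_bound':
  fixes p q r n s t B C u v :: int
  assumes prime: "prime p" and pq: "p < q" and pr: "p < r"
    and cop: "coprime p q" "coprime p r" "coprime q r"
    and n: "- q - r \<le> n" "n < p * q * r - q - r"
    and s: "1 \<le> s" "2 * s \<le> p" and t: "1 \<le> t" "2 * t \<le> p"
    and C: "0 \<le> C" "C \<le> r" "s * r + C * p = p * r + u" "\<bar>u\<bar> = 1"
    and B: "0 \<le> B" "B \<le> q" "t * q + B * p = p * q + v" "\<bar>v\<bar> = 1"
  shows "3 * \<bar>\<Sum>k\<in>{n - p + 1..n}. second_diff p q r (u * q) (v * r) k\<bar> \<le> 2 * p"
proof (cases "s \<le> t")
  case True
  then show ?thesis using window_bound[OF prime pq pr cop n s(1) True t(2) C B] by simp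
next
  case False
  have "3 * \<bar>\<Sum>k\<in>{n - p + 1..n}. second_diff p r q (v * r) (u * q) k\<bar> \<le> 2 * p"
    by (rule window_bound[where s = t and t = s and B = C and C = B])
      (use False assms in \<open>auto simp: coprime_commute algebra_simps\<close>)
  then show ?thesis by (subst second_diff_swap) simp
qed

lemma sum_second_diff_shift:
  "(\<Sum>k\<in>{n - p + 1..n}. second_diff p q r (- u) v k) = - (\<Sum>k\<in>{n + u - p + 1..n + u}. second_diff p q r u v k)"
proof -
  have "(\<Sum>k\<in>{n + u - p + 1..n + u}. second_diff p q r u v k) = (\<Sum>k\<in>{n - p + 1..n}. second_diff p q r u v (k + u))"
    by (rule sum.reindex_bij_witness[of _ "\<lambda>k. k + u" "\<lambda>k. k - u"]) auto
  also have "\<dots> = (\<Sum>k\<in>{n - p + 1..n}. - second_diff p q r (- u) v k)"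
    by (rule sum.cong) (auto simp: second_diff_def algebra_simps)
  finally show ?thesis by (simp add: sum_negf)
qed

text \<open>Negative signs from \<open>inverse_sign\<close> are absorbed by moving the window down
  by \<open>q\<close>, by \<open>r\<close> or by both; this is why the window bounds admit
  \<open>n\<close> down to \<open>- q - r\<close>.\<close>

theorem ternary_coeff_bound:
  fixes p q r n :: int
  assumes prime: "prime p" and pq: "p < q" and pr: "p < r"
    and cop: "coprime p q" "coprime p r" "coprime q r"
    and n: "0 \<le> n" "n < p * q * r - q - r"
  shows "3 * \<bar>\<Sum>k\<in>{n - p + 1..n}. second_diff p q r q r k\<bar> \<le> 2 * p"
proof -
  have p2: "2 \<le> p" using prime by (simp add: prime_ge_2_int)
  have pos: "0 < p" "0 < q" "0 < r" using p2 pq pr by auto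
  obtain s C u where C: "\<bar>u\<bar> = 1" "1 \<le> s" "2 * s \<le> p" "0 \<le> C" "C \<le> r" "s * r + C * p = p * r + u"
    using inverse_sign[OF p2 pr cop(2)] by blast
  obtain t B v where B: "\<bar>v\<bar> = 1" "1 \<le> t" "2 * t \<le> p" "0 \<le> B" "B \<le> q" "t * q + B * p = p * q + v"
    using inverse_sign[OF p2 pq cop(1)] by blast
  define W where "W n' u v = (\<Sum>k\<in>{n' - p + 1..n'}. second_diff p q r (u * q) (v * r) k)" for n' u v
  have W: "3 * \<bar>W n' u v\<bar> \<le> 2 * p" if "- q - r \<le> n'" "n' \<le> n" for n'
    unfolding W_def by (rule window_bound'[OF prime pq pr cop]) (use that n B C in auto)
  have flip_u: "W n' (- 1) v' = - W (n' + q) 1 v'" for n' v'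
    unfolding W_def using sum_second_diff_shift[of p q r q "v' * r" n'] by simp
  have flip_v: "W n' u' (- 1) = - W (n' + r) u' 1" for n' u'
    unfolding W_def using sum_second_diff_shift[of p r q r "u' * q" n'] second_diff_swap[of p q r] by simp
  have "u = 1 \<or> u = - 1" "v = 1 \<or> v = - 1" using B C by auto
  then have "3 * \<bar>W n 1 1\<bar> \<le> 2 * p"
    using W[of n] W[of "n - q"] W[of "n - r"] W[of "n - q - r"] n pos
      flip_u[of "n - q" 1] flip_v[of "n - r" 1] flip_u[of "n - q - r" "- 1"] flip_v[of "n - r" 1] by auto
  then show ?thesis unfolding W_def by simp
qed

section \<open>Ternary cyclotomic polynomials\<close>

definition unity_factor :: "nat \<Rightarrow> nat \<Rightarrow> complex poly" where
  "unity_factor n j = [:- exp (2 * of_real pi * \<i> * of_nat j / of_nat n), 1:]"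

text \<open>The right side is monic and squarefree, hence the product over its roots, the
  \<open>n\<close>-th roots of unity.\<close>

lemma prod_unity_factor:
  assumes n: "0 < n" shows "(\<Prod>j\<in>{1..n}. unity_factor n j) = monom 1 n - 1"
proof -
  have cis: "unity_factor n j = [:- cis (2 * pi * real j / real n), 1:]" for j
    unfolding unity_factor_def cis_conv_exp by (simp add: mult_ac)
  let ?Q = "monom 1 n - 1 :: complex poly"
  have root: "poly ?Q z = z ^ n - 1" for z by (simp add: poly_monom)
  have "rsquarefree ?Q"
    using n by (auto simp: rsquarefree_roots root pderiv_diff pderiv_monom poly_monom power_0_left)
  moreover have "lead_coeff ?Q = 1"
  proof -
    have "degree ?Q = n"
      using n degree_add_eq_left[of "-1 :: complex poly" "monom 1 n"] by (simp add: degree_monom_eq)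
    then show ?thesis using n by simp
  qed
  moreover have "{z. poly ?Q z = 0} = {z. z ^ n = 1}" by (simp add: poly_monom)
  ultimately have Q: "(\<Prod>z | z ^ n = 1. [:- z, 1:]) = ?Q"
    using complex_poly_decompose_rsquarefree[of ?Q] by (simp only: smult_1_left)
  have "(\<Prod>j\<in>{1..n}. unity_factor n j) = (\<Prod>j\<in>{..<n}. unity_factor n j)"
  proof -
    have e: "unity_factor n n = unity_factor n 0" unfolding cis using n by simp
    have "{1..n} = insert n {1..<n}" "{..<n} = insert 0 {1..<n}" using n by auto
    then show ?thesis using e by simp
  qed
  also have "\<dots> = (\<Prod>z | z ^ n = 1. [:- z, 1:])"
    unfolding cis by (rule prod.reindex_bij_betw[OF bij_betw_roots_unity[OF n]])
  finally show ?thesis using Q by simp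
qed

lemma prod_unity_factor_dvd:
  assumes "0 < d" "0 < m"
  shows "(\<Prod>j\<in>{1..d * m}. if d dvd j then unity_factor (d * m) j else 1) = monom 1 m - 1"
proof -
  have "(\<Prod>j\<in>{1..d * m}. if d dvd j then unity_factor (d * m) j else 1)
      = (\<Prod>j\<in>{j \<in> {1..d * m}. d dvd j}. unity_factor (d * m) j)"
    by (rule prod.inter_filter[symmetric]) simp
  also have "\<dots> = (\<Prod>i\<in>{1..m}. unity_factor m i)"
    by (rule prod.reindex_bij_witness[of _ "\<lambda>i. d * i" "\<lambda>j. j div d"])
      (use assms in \<open>auto simp: unity_factor_def mult.assoc elim!: dvdE\<close>)
  finally show ?thesis using prod_unity_factor[OF assms(2)] by simp
qed

lemma geometric_monom:
  "(\<Sum>a<p. monom 1 (a * k)) * (monom 1 k - 1) = (monom 1 (p * k) - 1 :: 'a :: comm_ring_1 poly)"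
proof (induction p)
  case (Suc p)
  have "(\<Sum>a<Suc p. monom 1 (a * k)) * (monom 1 k - 1) = (monom 1 (p * k) - 1) + monom 1 (p * k) * (monom 1 k - (1 :: 'a poly))"
    by (simp only: sum.lessThan_Suc distrib_right Suc)
  then show ?case by (simp add: right_diff_distrib mult_monom add.commute)
qed simp

lemma monom_minus_one_nz: "0 < k \<Longrightarrow> monom 1 k - 1 \<noteq> (0 :: 'a :: comm_ring_1 poly)"
  by (auto simp: poly_eq_iff intro!: exI[of _ k])

text \<open>With \<open>N = p * q * r\<close> this is the cube of \<open>x^N - 1\<close> divided by
  the binomials of exponents \<open>q * r\<close>, \<open>p * r\<close> and
  \<open>p * q\<close>.\<close>

definition ternary_poly :: "nat \<Rightarrow> nat \<Rightarrow> nat \<Rightarrow> complex poly" where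
  "ternary_poly p q r = (\<Sum>a<p. monom 1 (a * (q * r))) * (\<Sum>b<q. monom 1 (b * (p * r))) * (\<Sum>c<r. monom 1 (c * (p * q)))"

text \<open>
  By inclusion-exclusion over the divisors, the polynomial times the factors $x^{qr} - 1$, $x^{pr} - 1$,
  $x^{pq} - 1$, $x - 1$ equals $(x^{pqr} - 1)(x^p - 1)(x^q - 1)(x^r - 1)$.
\<close>
lemma cyclotomic_poly_ternary:
  assumes prime: "prime p" "prime q" "prime r" and neq: "p \<noteq> q" "p \<noteq> r" "q \<noteq> r"
  shows "cyclotomic_poly (p * q * r) * ((monom 1 (p * q * r) - 1) * (monom 1 (p * q * r) - 1))
     = (\<Sum>m<p. monom 1 m) * ((monom 1 q - 1) * ((monom 1 r - 1) * ternary_poly p q r))"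
proof -
  let ?N = "p * q * r" and ?M = "\<lambda>k. monom 1 k - 1 :: complex poly"
  let ?f = "unity_factor ?N" and ?J = "{1..?N}"
  have pos: "0 < p" "0 < q" "0 < r" using prime by (auto simp: prime_gt_0_nat)
  have cop: "coprime p q" "coprime p r" "coprime q r" using prime neq by (auto simp: primes_coprime)
  define A where "A d = (\<Prod>j\<in>?J. if d dvd j then ?f j else 1)" for d
  have Ad: "A d = ?M m" if "?N = d * m" "0 < d" "0 < m" for d m
    unfolding A_def that(1) by (rule prod_unity_factor_dvd[OF that(2,3)])
  have A: "A p = ?M (q * r)" "A q = ?M (p * r)" "A r = ?M (p * q)" "A (p * q) = ?M r"
      "A (p * r) = ?M q" "A (q * r) = ?M p" "A (p * q * r) = ?M 1" "A 1 = ?M ?N"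
    using pos by (auto intro!: Ad simp: mult_ac)
  have "cyclotomic_poly ?N = (\<Prod>j\<in>{j \<in> ?J. coprime j ?N}. ?f j)"
    unfolding cyclotomic_poly_def unity_factor_def by (rule prod.cong) auto
  also have "\<dots> = (\<Prod>j\<in>?J. if coprime j ?N then ?f j else 1)"
    by (rule prod.inter_filter) simp
  finally have Phi: "cyclotomic_poly ?N = (\<Prod>j\<in>?J. if coprime j ?N then ?f j else 1)" .
  \<comment> \<open>Index by index: how often the factor of \<open>j\<close> occurs on each side
    depends only on which of the three primes divide \<open>j\<close>.\<close>
  have "cyclotomic_poly ?N * A p * A q * A r * A (p * q * r) = A 1 * A (p * q) * A (p * r) * A (q * r)"
    unfolding Phi A_def prod.distrib[symmetric]
  proof (rule prod.cong[OF refl])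
    fix j assume "j \<in> ?J"
    have c: "coprime j x \<longleftrightarrow> \<not> x dvd j" if "prime x" for x
      using that by (metis coprime_commute prime_imp_coprime coprime_common_divisor_nat dvd_refl not_prime_1)
    have i1: "coprime j ?N \<longleftrightarrow> \<not> p dvd j \<and> \<not> q dvd j \<and> \<not> r dvd j" using c prime by simp
    have i2: "p * q dvd j \<longleftrightarrow> p dvd j \<and> q dvd j" "p * r dvd j \<longleftrightarrow> p dvd j \<and> r dvd j"
      "q * r dvd j \<longleftrightarrow> q dvd j \<and> r dvd j" "p * q * r dvd j \<longleftrightarrow> p dvd j \<and> q dvd j \<and> r dvd j"
      using cop by (auto intro: divides_mult dest: dvd_mult_left dvd_mult_right)
    show "(if coprime j ?N then ?f j else 1) * (if p dvd j then ?f j else 1) * (if q dvd j then ?f j else 1)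
        * (if r dvd j then ?f j else 1) * (if p * q * r dvd j then ?f j else 1)
      = (if 1 dvd j then ?f j else 1) * (if p * q dvd j then ?f j else 1) * (if p * r dvd j then ?f j else 1)
        * (if q * r dvd j then ?f j else 1)"
      unfolding i1 i2 by (cases "p dvd j"; cases "q dvd j"; cases "r dvd j") simp_all
  qed
  then have 1: "cyclotomic_poly ?N * ?M (q * r) * ?M (p * r) * ?M (p * q) * ?M 1 = ?M ?N * ?M r * ?M q * ?M p"
    unfolding A .
  define Ga Gb Gc P where "Ga = (\<Sum>a<p. monom 1 (a * (q * r)) :: complex poly)"
    and "Gb = (\<Sum>b<q. monom 1 (b * (p * r)) :: complex poly)"
    and "Gc = (\<Sum>c<r. monom 1 (c * (p * q)) :: complex poly)" and "P = (\<Sum>m<p. monom 1 m :: complex poly)"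
  have G: "Ga * ?M (q * r) = ?M ?N" "Gb * ?M (p * r) = ?M ?N" "Gc * ?M (p * q) = ?M ?N"
    unfolding Ga_def Gb_def Gc_def geometric_monom by (simp_all add: mult_ac)
  have P1: "P * ?M 1 = ?M p" using geometric_monom[of 1 p, where 'a = complex] unfolding P_def by simp
  \<comment> \<open>The extra factor \<open>?M ?N * ?M 1\<close> makes the geometric sums applicable
    and is cancelled at the end.\<close>
  have "(?M ?N * ?M 1) * (cyclotomic_poly ?N * (?M ?N * ?M ?N))
     = cyclotomic_poly ?N * (Ga * ?M (q * r)) * (Gb * ?M (p * r)) * (Gc * ?M (p * q)) * ?M 1"
    unfolding G by (simp only: mult_ac)
  also have "\<dots> = (cyclotomic_poly ?N * ?M (q * r) * ?M (p * r) * ?M (p * q) * ?M 1) * (Ga * Gb * Gc)"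
    by (simp only: mult_ac)
  also have "\<dots> = (?M ?N * ?M r * ?M q * (P * ?M 1)) * (Ga * Gb * Gc)" unfolding 1 P1 ..
  also have "\<dots> = (?M ?N * ?M 1) * (P * (?M q * (?M r * (Ga * Gb * Gc))))" by (simp only: mult_ac)
  finally have "cyclotomic_poly ?N * (?M ?N * ?M ?N) = P * (?M q * (?M r * (Ga * Gb * Gc)))"
    using monom_minus_one_nz[of ?N] monom_minus_one_nz[of 1] pos by (subst (asm) mult_left_cancel) auto
  then show ?thesis unfolding Ga_def Gb_def Gc_def P_def ternary_poly_def .
qed

section \<open>Coefficients as window sums\<close>

text \<open>Extension by zero to negative indices turns multiplication by a monomial into a
  translation without boundary cases.\<close>

definition icoeff :: "'a :: comm_ring_1 poly \<Rightarrow> int \<Rightarrow> 'a" where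
  "icoeff P k = (if k < 0 then 0 else coeff P (nat k))"

lemma icoeff_simps:
  "icoeff (P + Q) k = icoeff P k + icoeff Q k" "icoeff (P - Q) k = icoeff P k - icoeff Q k"
  "icoeff (monom 1 j * P) k = icoeff P (k - int j)"
  by (auto simp: icoeff_def coeff_monom_mult nat_diff_distrib)

lemma icoeff_sum: "icoeff (\<Sum>i\<in>I. f i) k = (\<Sum>i\<in>I. icoeff (f i) k)"
  by (simp add: icoeff_def coeff_sum)

lemma icoeff_monom_minus_one: "icoeff ((monom 1 j - 1) * P) k = icoeff P (k - int j) - icoeff P k"
  by (simp add: left_diff_distrib icoeff_simps)

lemma sum_product3:
  fixes f g h :: "_ \<Rightarrow> 'a :: comm_ring_1"
  shows "(\<Sum>a\<in>A. f a) * (\<Sum>b\<in>B. g b) * (\<Sum>c\<in>C. h c) = (\<Sum>(a, b, c)\<in>A \<times> B \<times> C. f a * g b * h c)"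
  by (simp add: sum.cartesian_product[symmetric] sum_distrib_left[symmetric] sum_distrib_right[symmetric])

text \<open>Distinct digit triples have distinct exponents, so no coefficient exceeds 1.\<close>

lemma icoeff_ternary_poly:
  assumes cop: "coprime p q" "coprime p r" "coprime q r" and pos: "0 < p" "0 < q" "0 < r"
  shows "icoeff (ternary_poly p q r) k = of_bool (representable (int p) (int q) (int r) k)"
proof -
  let ?A = "{..<p} \<times> {..<q} \<times> {..<r}"
  define g where "g = (\<lambda>(a, b, c). a * (q * r) + b * (p * r) + c * (p * q))"
  have rep: "ternary_rep p q r k a b c 0 \<longleftrightarrow> (\<exists>a' b' c'. a = int a' \<and> b = int b' \<and> c = int c' \<and>
      (a', b', c') \<in> ?A \<and> int (g (a', b', c')) = k)" for a b c k
  proof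
    assume r: "ternary_rep p q r k a b c 0"
    then show "\<exists>a' b' c'. a = int a' \<and> b = int b' \<and> c = int c' \<and> (a', b', c') \<in> ?A \<and> int (g (a', b', c')) = k"
      unfolding ternary_rep_def g_def
      by (intro exI[of _ "nat a"] exI[of _ "nat b"] exI[of _ "nat c"]) auto
  qed (auto simp: ternary_rep_def g_def)
  have "inj_on g ?A"
  proof (rule inj_onI)
    fix x y assume xy: "x \<in> ?A" "y \<in> ?A" "g x = g y"
    obtain a b c where x: "x = (a, b, c)" by (metis surj_pair)
    obtain a' b' c' where y: "y = (a', b', c')" by (metis surj_pair)
    have "ternary_rep p q r (g x) a b c 0" "ternary_rep p q r (g x) a' b' c' 0"
      using xy rep unfolding x y by auto
    then show "x = y" using ternary_rep_unique[of "int p" "int q" "int r"] cop pos unfolding x y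
      by (metis coprime_int_iff of_nat_0_less_iff of_nat_eq_iff)
  qed
  have "ternary_poly p q r = (\<Sum>x\<in>?A. monom 1 (g x))"
    unfolding ternary_poly_def g_def sum_product3 by (rule sum.cong) (auto simp: mult_monom)
  also have "\<dots> = (\<Sum>j\<in>g ` ?A. monom 1 j)" using \<open>inj_on g ?A\<close> by (simp add: sum.reindex)
  finally have "coeff (ternary_poly p q r) n = of_bool (n \<in> g ` ?A)" for n
    by (simp add: coeff_sum sum.delta)
  moreover have "(\<exists>x\<in>A. int (g x) = k) \<longleftrightarrow> 0 \<le> k \<and> nat k \<in> g ` A" for A
    by (auto simp: image_iff intro: bexI[rotated])
  ultimately have "icoeff (ternary_poly p q r) k = of_bool (\<exists>x\<in>?A. int (g x) = k)"
    unfolding icoeff_def by (simp only:) auto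
  also have "(\<exists>x\<in>?A. int (g x) = k) \<longleftrightarrow> representable p q r k"
    unfolding representable_def rep by blast
  finally show ?thesis .
qed

text \<open>Below degree \<open>p * q * r\<close> the squared factor in
  \<open>cyclotomic_poly_ternary\<close> acts as 1. The binomials in \<open>q\<close> and
  \<open>r\<close> produce the second difference, and the sum over \<open>m < p\<close> the
  window.\<close>

lemma coeff_cyclotomic_poly_ternary:
  assumes prime: "prime p" "prime q" "prime r" and neq: "p \<noteq> q" "p \<noteq> r" "q \<noteq> r" and n: "n < p * q * r"
  shows "coeff (cyclotomic_poly (p * q * r)) n
    = of_int (\<Sum>k\<in>{int n - int p + 1..int n}. second_diff (int p) (int q) (int r) (int q) (int r) k)"
proof -
  let ?N = "p * q * r" and ?Y = "ternary_poly p q r"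
  have pos: "0 < p" "0 < q" "0 < r" using prime by (auto simp: prime_gt_0_nat)
  have cop: "coprime p q" "coprime p r" "coprime q r" using prime neq by (auto simp: primes_coprime)
  note Y = icoeff_ternary_poly[OF cop pos]
  let ?Z = "(monom 1 q - 1) * ((monom 1 r - 1) * ?Y)"
  have Z: "icoeff ?Z k = of_int (second_diff p q r q r k)" for k
    unfolding icoeff_monom_minus_one Y second_diff_def by (simp add: algebra_simps)
  have "icoeff (cyclotomic_poly ?N * ((monom 1 ?N - 1) * (monom 1 ?N - 1))) n = coeff (cyclotomic_poly ?N) n"
  proof -
    have "cyclotomic_poly ?N * ((monom 1 ?N - 1) * (monom 1 ?N - 1))
      = (monom 1 ?N - 1) * ((monom 1 ?N - 1) * cyclotomic_poly ?N)" by (simp only: mult_ac)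
    moreover have "icoeff P (int n - int ?N) = 0" for P :: "complex poly"
    proof -
      have "int n < int ?N" using n by (simp only: of_nat_less_iff)
      then show ?thesis unfolding icoeff_def by (simp only: if_P)
    qed
    ultimately show ?thesis by (simp only: icoeff_monom_minus_one) (simp add: icoeff_def)
  qed
  then have "coeff (cyclotomic_poly ?N) n = icoeff ((\<Sum>m<p. monom 1 m) * ?Z) n"
    unfolding cyclotomic_poly_ternary[OF prime neq] by simp
  also have "\<dots> = (\<Sum>m<p. icoeff ?Z (int n - int m))"
    by (simp only: sum_distrib_right icoeff_sum icoeff_simps)
  also have "\<dots> = (\<Sum>k\<in>{int n - int p + 1..int n}. icoeff ?Z k)"
    by (rule sum.reindex_bij_witness[of _ "\<lambda>k. nat (int n - k)" "\<lambda>m. int n - int m"]) auto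
  finally show ?thesis unfolding Z by simp
qed

section \<open>Heights\<close>

text \<open>The degree is below \<open>p * q * r - q - r\<close>, so
  \<open>ternary_coeff_bound\<close> covers every coefficient. Integrality of the height is recorded
  for the finiteness argument that follows.\<close>

lemma cyclotomic_height_ternary:
  assumes prime: "prime p" "prime q" "prime r" and pq: "p < q" and qr: "q < r"
  shows "\<exists>h :: nat. cyclotomic_height (p * q * r) = real h \<and> 3 * h \<le> 2 * p"
proof -
  let ?N = "p * q * r"
  let ?S = "{cmod (coeff (cyclotomic_poly ?N) k) | k. k \<le> totient ?N}"
  have cop: "coprime p q" "coprime p r" "coprime q r" using prime pq qr by (auto simp: primes_coprime)
  have ge: "2 \<le> p" "2 \<le> q" "2 \<le> r" using prime by (auto simp: prime_ge_2_nat)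
  have tot: "int (totient ?N) < int p * int q * int r - int q - int r"
  proof -
    have "totient ?N = (p - 1) * (q - 1) * (r - 1)"
      using cop prime by (simp add: totient_mult_coprime totient_prime)
    then have "int (totient ?N) = (int p - 1) * (int q - 1) * (int r - 1)" using ge by (simp add: of_nat_diff)
    also have "\<dots> = int p * int q * int r - int p * int q - int p * int r - int q * int r + int p + int q + int r - 1"
      by (simp add: algebra_simps)
    finally show ?thesis
    proof -
      assume e: "int (totient ?N) = int p * int q * int r - int p * int q - int p * int r - int q * int r + int p + int q + int r - 1"
      have "2 * int q \<le> int p * int q" "2 * int r \<le> int p * int r" "2 * int r \<le> int q * int r"
        using ge by (auto intro!: mult_right_mono)
      then show ?thesis using e pq qr by linarith
    qed
  qed
  have S: "\<exists>h :: nat. x = real h \<and> 3 * h \<le> 2 * p" if xS: "x \<in> ?S" for x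
  proof -
    obtain k where k: "x = cmod (coeff (cyclotomic_poly ?N) k)" "k \<le> totient ?N" using xS by blast
    let ?c = "\<Sum>j\<in>{int k - int p + 1..int k}. second_diff (int p) (int q) (int r) (int q) (int r) j"
    have kN: "int k < int p * int q * int r - int q - int r" using k(2) tot by linarith
    then have "int k < int (p * q * r)" by simp
    then have "k < p * q * r" by (simp only: of_nat_less_iff)
    then have "x = cmod (of_int ?c)"
      unfolding k(1) using pq qr by (subst coeff_cyclotomic_poly_ternary[OF prime]) auto
    moreover have "cmod (of_int y) = real (nat \<bar>y\<bar>)" for y by simp
    ultimately have "x = real (nat \<bar>?c\<bar>)" by (simp only:)
    moreover have "3 * \<bar>?c\<bar> \<le> 2 * int p"
      by (rule ternary_coeff_bound) (use prime pq qr cop kN in auto)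
    ultimately show ?thesis by (intro exI[of _ "nat \<bar>?c\<bar>"]) auto
  qed
  have "finite ?S" by simp
  moreover have "?S \<noteq> {}" by auto
  ultimately have "Max ?S \<in> ?S" by (rule Max_in)
  then show ?thesis using S unfolding cyclotomic_height_def by blast
qed

theorem theorem1p3:
  fixes p :: nat
  assumes "prime p"
  shows "max_ternary_height p \<le> 2 / 3 * real p"
proof -
  let ?M = "{cyclotomic_height (p * q * r) | q r. prime q \<and> prime r \<and> p < q \<and> q < r}"
  have M: "\<exists>h :: nat. x = real h \<and> 3 * h \<le> 2 * p" if "x \<in> ?M" for x
    using that cyclotomic_height_ternary[OF assms] by blast
  \<comment> \<open>Infinitely many pairs \<open>q\<close>, \<open>r\<close> occur, but bounded
    natural heights form a finite set, so \<open>Max\<close> is attained.\<close>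
  have "?M \<subseteq> real ` {..2 * p}"
  proof
    fix x assume "x \<in> ?M"
    from M[OF this] obtain h :: nat where "x = real h" "3 * h \<le> 2 * p" by blast
    then show "x \<in> real ` {..2 * p}" by simp
  qed
  then have "finite ?M" using finite_subset by blast
  moreover have "?M \<noteq> {}"
  proof -
    obtain q where q: "prime q" "p < q" using bigger_prime by blast
    obtain r where "prime r" "q < r" using bigger_prime by blast
    then show ?thesis using q by blast
  qed
  ultimately have "Max ?M \<in> ?M" by (rule Max_in)
  from M[OF this] show ?thesis unfolding max_ternary_height_def by auto
qed

end
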